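(* The class of normally almost monomial finite groups is closed under taking factor groups and direct products, and so is the class of subnormally almost monomial finite groups. That is: (a) if $G$ is a normally (respectively, subnormally) almost monomial finite group and $N\unlhd G$, then $G/N$ is normally (respectively, subnormally) almost monomial; (b) if $G_1$ and $G_2$ are normally (respectively, subnormally) almost monomial finite groups, then $G_1\times G_2$ is normally (respectively, subnormally) almost monomial.
   Context: All characters are complex characters of finite groups, and $\operatorname{Irr}(G)$ is the set of irreducible characters of $G$. A linear character is a character of degree $1$. For $H\leqslant G$ and a character $\theta$ of $H$, $\theta^G$ denotes the character of $G$ induced by $\theta$. For a character $\chi$ of $G$, $\operatorname{Cons}(\chi):=\{\phi\in\operatorname{Irr}(G):\langle\phi,\chi\rangle>0\}$ is its set of constituents. A finite group $G$ is called normally almost monomial (an nAM-group) if for any $\chi\neq\phi\in\operatorname{Irr}(G)$ there exist a normal subgroup $N\unlhd G$ and a linear character $\lambda$ of $N$ such that $\chi\in\operatorname{Cons}(\lambda^G)$ and $\phi\notin\operatorname{Cons}(\lambda^G)$. A finite group $G$ is called subnormally almost monomial (an sAM-group) if for any $\chi\neq\phi\in\operatorname{Irr}(G)$ there exist a subnormal subgroup $H$ of $G$ and a linear character $\lambda$ of $H$ such that $\chi\in\operatorname{Cons}(\lambda^G)$ and $\phi\notin\operatorname{Cons}(\lambda^G)$. *)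

theory Defs
  imports
    "HOL-Algebra.Coset"
    "HOL-Library.Complex_Order"
    "Jordan_Normal_Form.VS_Connect"
begin

definition representation ::
    "('a, 'b) monoid_scheme \<Rightarrow> nat \<Rightarrow> ('a \<Rightarrow> complex mat) \<Rightarrow> bool" where
  "representation G n \<rho> \<longleftrightarrow> 0 < n \<and> \<rho> \<in> hom G (units_of (ring_mat TYPE(complex) n ()))"

definition irreducible_representation ::
    "('a, 'b) monoid_scheme \<Rightarrow> nat \<Rightarrow> ('a \<Rightarrow> complex mat) \<Rightarrow> bool" where
  "irreducible_representation G n \<rho> \<longleftrightarrow>
     representation G n \<rho> \<and>
     (\<forall>W. VectorSpace.subspace class_ring W (module_vec TYPE(complex) n) \<and>
          (\<forall>g\<in>carrier G. \<forall>w\<in>W. \<rho> g *\<^sub>v w \<in> W)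
        \<longrightarrow> W = {0\<^sub>v n} \<or> W = carrier_vec n)"

definition mat_trace :: "complex mat \<Rightarrow> complex" where
  "mat_trace A = (\<Sum>i<dim_row A. A $$ (i, i))"

text \<open>Class functions are \<open>undefined\<close> outside the carrier, so that two characters
  of \<open>G\<close> are equal as HOL functions iff they agree on \<open>G\<close>.\<close>

definition afforded_character ::
    "('a, 'b) monoid_scheme \<Rightarrow> ('a \<Rightarrow> complex mat) \<Rightarrow> 'a \<Rightarrow> complex" where
  "afforded_character G \<rho> = (\<lambda>g\<in>carrier G. mat_trace (\<rho> g))"

definition is_character :: "('a, 'b) monoid_scheme \<Rightarrow> ('a \<Rightarrow> complex) \<Rightarrow> bool" where
  "is_character G \<chi> \<longleftrightarrow> (\<exists>n \<rho>. representation G n \<rho> \<and> \<chi> = afforded_character G \<rho>)"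

definition Irr :: "('a, 'b) monoid_scheme \<Rightarrow> ('a \<Rightarrow> complex) set" where
  "Irr G = {\<chi>. \<exists>n \<rho>. irreducible_representation G n \<rho> \<and> \<chi> = afforded_character G \<rho>}"

definition linear_character :: "('a, 'b) monoid_scheme \<Rightarrow> ('a \<Rightarrow> complex) \<Rightarrow> bool" where
  "linear_character G \<chi> \<longleftrightarrow> is_character G \<chi> \<and> \<chi> \<one>\<^bsub>G\<^esub> = 1"

definition char_inner ::
    "('a, 'b) monoid_scheme \<Rightarrow> ('a \<Rightarrow> complex) \<Rightarrow> ('a \<Rightarrow> complex) \<Rightarrow> complex" where
  "char_inner G \<phi> \<chi> = (\<Sum>g\<in>carrier G. \<phi> g * cnj (\<chi> g)) / of_nat (card (carrier G))"

text \<open>In the order of \<open>Complex_Order\<close>, \<open>0 < z\<close> says that \<open>z\<close> is real and positive.\<close>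

definition Cons :: "('a, 'b) monoid_scheme \<Rightarrow> ('a \<Rightarrow> complex) \<Rightarrow> ('a \<Rightarrow> complex) set" where
  "Cons G \<chi> = {\<phi> \<in> Irr G. 0 < char_inner G \<phi> \<chi>}"

text \<open>The character of \<open>G\<close> induced by \<open>\<theta>\<close> on \<open>H\<close>:
  \<open>\<theta>\<^sup>G(g) = 1/|H| \<Sum>\<^sub>x\<^sub>\<in>\<^sub>G \<theta>\<degree>(x g x\<inverse>)\<close>, where \<open>\<theta>\<degree>\<close> extends \<open>\<theta>\<close> by zero off \<open>H\<close>.\<close>

definition induced_character ::
    "('a, 'b) monoid_scheme \<Rightarrow> 'a set \<Rightarrow> ('a \<Rightarrow> complex) \<Rightarrow> 'a \<Rightarrow> complex" where
  "induced_character G H \<theta> =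
     (\<lambda>g\<in>carrier G.
        (\<Sum>x\<in>carrier G.
           let y = x \<otimes>\<^bsub>G\<^esub> g \<otimes>\<^bsub>G\<^esub> inv\<^bsub>G\<^esub> x in if y \<in> H then \<theta> y else 0) / of_nat (card H))"

inductive subnormal :: "('a, 'b) monoid_scheme \<Rightarrow> 'a set \<Rightarrow> bool" for G where
  whole: "subnormal G (carrier G)"
| step: "subnormal G K \<Longrightarrow> H \<lhd> G\<lparr>carrier := K\<rparr> \<Longrightarrow> subnormal G H"

definition nAM_group :: "('a, 'b) monoid_scheme \<Rightarrow> bool" where
  "nAM_group G \<longleftrightarrow> group G \<and> finite (carrier G) \<and>
     (\<forall>\<chi>\<in>Irr G. \<forall>\<phi>\<in>Irr G. \<chi> \<noteq> \<phi> \<longrightarrow>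
        (\<exists>N \<mu>. N \<lhd> G \<and> linear_character (G\<lparr>carrier := N\<rparr>) \<mu> \<and>
           \<chi> \<in> Cons G (induced_character G N \<mu>) \<and>
           \<phi> \<notin> Cons G (induced_character G N \<mu>)))"

definition sAM_group :: "('a, 'b) monoid_scheme \<Rightarrow> bool" where
  "sAM_group G \<longleftrightarrow> group G \<and> finite (carrier G) \<and>
     (\<forall>\<chi>\<in>Irr G. \<forall>\<phi>\<in>Irr G. \<chi> \<noteq> \<phi> \<longrightarrow>
        (\<exists>H \<mu>. subnormal G H \<and> linear_character (G\<lparr>carrier := H\<rparr>) \<mu> \<and>
           \<chi> \<in> Cons G (induced_character G H \<mu>) \<and>
           \<phi> \<notin> Cons G (induced_character G H \<mu>)))"

end

theory Submission
  imports Defs "Jordan_Normal_Form.DL_Rank" "Jordan_Normal_Form.Spectral_Radius"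
begin

text \<open>
  Factor groups and direct products are both instances of one situation: a group \<open>G\<close> whose elements
  are the products \<open>f a \<otimes> h b\<close> for homomorphisms \<open>f\<close> from \<open>A\<close> and \<open>h\<close> from \<open>B\<close> with elementwise
  commuting images. For a direct product \<open>f\<close> and \<open>h\<close> are the two inclusions; for \<open>G Mod N\<close> they are
  the projection from \<open>G\<close> and the trivial homomorphism. The proof shows that \<open>G\<close> belongs to the class
  whenever \<open>A\<close> and \<open>B\<close> do.

  The character theory rests on one consequence of Schur's lemma (\<open>schur_trace\<close>), which evaluates
  \<open>\<Sum>g. mat_trace (C * (\<rho> g * A * \<rho> (inv g)))\<close> for an irreducible representation \<open>\<rho>\<close>. It has three
  effects for an irreducible character \<open>\<chi>\<close> of \<open>G\<close>. The pullback of \<open>\<chi>\<close> to \<open>A\<close> is a positive multiple of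
  an irreducible character (\<open>Irr_pullback_multiple\<close>). The product formula
  \<open>\<chi> \<one> * \<chi> (f a \<otimes> h b) = \<chi> (f a) * \<chi> (h b)\<close> holds, by \<open>Irr_product_formula\<close>. Proportional irreducible
  characters with a positive factor are equal (\<open>Irr_proportional_eq\<close>). Together, different irreducible
  characters of \<open>G\<close> have pullbacks to \<open>A\<close> or to \<open>B\<close>, say to \<open>A\<close>, that are multiples of different
  irreducible characters.

  These are separated by some linear character \<open>\<mu>\<close> of a subgroup \<open>H\<close> of \<open>A\<close>. It remains to transport
  \<open>\<mu>\<close> to the subgroup \<open>f ` H\<close> of \<open>G\<close> (\<open>separate_by_pushforward\<close>). Frobenius reciprocity and a
  translation argument show that \<open>\<mu>\<close> is trivial on the kernel of \<open>f\<close>, and that the inner products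
  keep their signs. Finally, conjugation by an element of \<open>G\<close> acts on the image of \<open>f\<close> like conjugation
  by an element of \<open>A\<close>, so that \<open>f ` H\<close> is again normal, respectively subnormal.
\<close>

section \<open>Retractions onto subspaces\<close>

lemma injective_imp_left_inverse:
  fixes P :: "complex mat"
  assumes P: "P \<in> carrier_mat n m"
    and inj: "\<And>x. x \<in> carrier_vec m \<Longrightarrow> P *\<^sub>v x = 0\<^sub>v n \<Longrightarrow> x = 0\<^sub>v m"
  obtains Q where "Q \<in> carrier_mat m n" "Q * P = 1\<^sub>m m"
proof -
  (* With H the conjugate transpose of P, the Gram matrix H * P is invertible: if it kills x,
     then y = P x is orthogonal to every column of P, hence to itself. *)
  define H where "H = mat m n (\<lambda>(i,j). cnj (P $$ (j,i)))"
  have H: "H \<in> carrier_mat m n" by (simp add: H_def)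
  have HP: "H * P \<in> carrier_mat m m" using H P by simp
  have "x = 0\<^sub>v m" if x: "x \<in> carrier_vec m" and z: "(H * P) *\<^sub>v x = 0\<^sub>v m" for x
  proof -
    define y where "y = P *\<^sub>v x"
    have y: "y \<in> carrier_vec n" using P x by (simp add: y_def)
    have Hy: "H *\<^sub>v y = 0\<^sub>v m" unfolding y_def using z H P x by (simp add: assoc_mult_mat_vec)
    have col: "(\<Sum>k<n. cnj (P $$ (k,i)) * y $ k) = 0" if "i < m" for i
    proof -
      have "(H *\<^sub>v y) $ i = (\<Sum>k<n. cnj (P $$ (k,i)) * y $ k)"
        using that H y by (simp add: scalar_prod_def H_def lessThan_atLeast0)
      then show ?thesis using Hy that by simp
    qed
    have yk: "y $ k = (\<Sum>i<m. P $$ (k,i) * x $ i)" if "k < n" for k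
      using that P x by (simp add: y_def scalar_prod_def lessThan_atLeast0)
    have "(\<Sum>k<n. y $ k * cnj (y $ k)) = (\<Sum>k<n. \<Sum>i<m. cnj (x $ i) * (cnj (P $$ (k,i)) * y $ k))"
      by (intro sum.cong refl) (subst (2) yk, auto simp: sum_distrib_left mult_ac)
    also have "\<dots> = (\<Sum>i<m. cnj (x $ i) * (\<Sum>k<n. cnj (P $$ (k,i)) * y $ k))"
      by (subst sum.swap) (simp add: sum_distrib_left)
    also have "\<dots> = 0" using col by simp
    finally have "(\<Sum>k<n. complex_of_real ((cmod (y $ k))\<^sup>2)) = 0"
      by (simp add: complex_norm_square del: of_real_power)
    then have "(\<Sum>k<n. (cmod (y $ k))\<^sup>2) = 0"
      by (metis of_real_eq_0_iff of_real_sum)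
    then have "y = 0\<^sub>v n"
      using y by (intro eq_vecI) (auto simp: sum_nonneg_eq_0_iff)
    then show ?thesis using inj x by (simp add: y_def)
  qed
  then have "det (H * P) \<noteq> 0"
    using det_0_iff_vec_prod_zero_field[OF HP] by blast
  from det_non_zero_imp_unit[OF HP this, of "()"] obtain B
    where B: "B \<in> carrier_mat m m" "B * (H * P) = 1\<^sub>m m"
    unfolding Units_def ring_mat_simps by auto
  show ?thesis
    by (rule that[of "B * H"]) (use B H P in \<open>auto simp: assoc_mult_mat\<close>)
qed

text \<open>A basis of \<open>W\<close> gives the columns of \<open>P\<close>, and a left inverse \<open>Q\<close> of \<open>P\<close> gives the projection
  \<open>P * Q\<close> onto \<open>W\<close>. The strict bounds on \<open>m\<close> let an induction on the degree pass from a
  representation to an invariant subspace.\<close>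

lemma subspace_retraction:
  fixes W :: "complex vec set"
  assumes W: "VectorSpace.subspace class_ring W (module_vec TYPE(complex) n)"
    and proper: "W \<noteq> {0\<^sub>v n}" "W \<noteq> carrier_vec n"
  obtains m P Q where "0 < m" "m < n" "P \<in> carrier_mat n m" "Q \<in> carrier_mat m n"
    "Q * P = 1\<^sub>m m" "\<And>j. j < m \<Longrightarrow> col P j \<in> W"
    "\<And>w. w \<in> W \<Longrightarrow> P *\<^sub>v (Q *\<^sub>v w) = w"
proof -
  interpret vec_space "TYPE(complex)" n .
  have sub: "submodule class_ring W V" using W by (simp add: subspace_def)
  have WV: "W \<subseteq> carrier_vec n" using submodule.subset[OF sub] by simp
  (* A largest independent subset of W is a basis of W. *)
  define S where "S = {card B | B. B \<subseteq> W \<and> lin_indpt B}"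
  have bound: "finite B" "card B \<le> n" if "B \<subseteq> W" "lin_indpt B" for B
    using li_le_dim[of B] that WV by (auto simp: dim_is_n)
  have "finite S" by (rule finite_subset[of _ "{..n}"]) (auto simp: S_def bound)
  moreover have "card {} \<in> S" unfolding S_def by (auto simp: lin_dep_def intro!: exI[of _ "{}"])
  ultimately have "Max S \<in> S" by (intro Max_in) auto
  then obtain B where B: "B \<subseteq> W" "lin_indpt B" "card B = Max S" by (auto simp: S_def)
  have finB: "finite B" using bound B by blast
  have BV: "B \<subseteq> carrier_vec n" using B WV by auto
  have WB: "W \<subseteq> span B"
  proof
    fix w assume w: "w \<in> W"
    show "w \<in> span B"
    proof (rule ccontr)
      assume nw: "w \<notin> span B"
      have "w \<notin> B" using nw in_own_span[of B] BV by auto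
      then have "lin_indpt (B \<union> {w})"
        using lin_dep_iff_in_span[of B w] B BV w WV nw by auto
      then have "card (B \<union> {w}) \<in> S" using B w by (auto simp: S_def)
      then have "card (B \<union> {w}) \<le> card B" using \<open>finite S\<close> B by auto
      then show False using \<open>w \<notin> B\<close> finB by auto
    qed
  qed
  have BW: "span B \<subseteq> W" using span_is_subset[OF B(1) sub] .
  have "card B \<noteq> n"
  proof
    assume "card B = n"
    then have "basis B" using dim_li_is_basis[of B] finB BV B by (simp add: dim_is_n)
    then show False using BW WV proper by (auto simp: basis_def)
  qed
  moreover have "card B \<le> n" using bound B by blast
  moreover have "card B \<noteq> 0"
  proof
    assume "card B = 0"
    then have "B = {}" using finB by simp
    then have "W \<subseteq> {0\<^sub>v n}" using WB span_empty by simp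
    then show False using proper submodule.zero_closed[OF sub] by auto
  qed
  ultimately have m: "0 < card B" "card B < n" by auto
  obtain ws where ws: "distinct ws" "set ws = B"
    using finite_distinct_list[OF finB] by blast
  have len: "length ws = card B" using ws distinct_card by fastforce
  have dims: "\<forall>w\<in>set ws. dim_vec w = n" using ws BV by auto
  define P where "P = mat_of_cols n ws"
  have P: "P \<in> carrier_mat n (card B)" by (simp add: P_def len[symmetric])
  have colsP: "cols P = ws" using ws BV by (simp add: P_def)
  have "x = 0\<^sub>v (card B)" if "x \<in> carrier_vec (card B)" "P *\<^sub>v x = 0\<^sub>v n" for x
    using lin_depI[OF P that(1) _ that(2)] ws B colsP by auto
  then obtain Q where Q: "Q \<in> carrier_mat (card B) n" "Q * P = 1\<^sub>m (card B)"
    using injective_imp_left_inverse[OF P] by blast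
  have "P *\<^sub>v (Q *\<^sub>v w) = w" if w: "w \<in> W" for w
  proof -
    obtain a where a: "w = lincomb a B" using w WB finB BV finite_in_span by blast
    then have "w = lincomb_list (\<lambda>i. a (ws ! i)) ws"
      using lincomb_as_lincomb_list_distinct[of ws a] ws BV by simp
    then have "w = P *\<^sub>v vec (length ws) (\<lambda>i. a (ws ! i))" (is "_ = P *\<^sub>v ?x")
      using lincomb_list_as_mat_mult[of ws] dims by (simp add: P_def)
    moreover have x: "?x \<in> carrier_vec (card B)" using len by simp
    moreover have "Q *\<^sub>v (P *\<^sub>v ?x) = ?x"
      using assoc_mult_mat_vec[OF Q(1) P x] Q(2) x by simp
    ultimately show ?thesis by simp
  qed
  moreover have "col P j \<in> W" if "j < card B" for j
  proof -
    have "col P j = ws ! j" using P that colsP by (metis carrier_matD(2) cols_nth)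
    then show ?thesis using that len ws B by (metis nth_mem subsetD)
  qed
  ultimately show thesis using that[OF m P Q] by blast
qed

section \<open>Schur's lemma and the averaged trace\<close>

lemma representation_iff:
  assumes "group G"
  shows "representation G n \<rho> \<longleftrightarrow>
    0 < n \<and> (\<forall>g\<in>carrier G. \<rho> g \<in> carrier_mat n n) \<and> \<rho> \<one>\<^bsub>G\<^esub> = 1\<^sub>m n \<and>
    (\<forall>g\<in>carrier G. \<forall>h\<in>carrier G. \<rho> (g \<otimes>\<^bsub>G\<^esub> h) = \<rho> g * \<rho> h)" (is "?L \<longleftrightarrow> ?R")
proof
  interpret G: group G by fact
  interpret M: ring "ring_mat TYPE(complex) n ()" by (rule ring_mat)
  {
    assume ?L
    then have n: "0 < n" and h: "\<rho> \<in> hom G (units_of (ring_mat TYPE(complex) n ()))"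
      by (auto simp: representation_def)
    from hom_one[OF h G.is_group M.units_group]
    have "\<rho> \<one>\<^bsub>G\<^esub> = 1\<^sub>m n" by (simp add: units_of_def ring_mat_simps)
    with n h show ?R
      by (auto simp: hom_def units_of_def Units_def ring_mat_simps Pi_iff)
  next
    assume R: ?R
    have "\<rho> g \<in> Units (ring_mat TYPE(complex) n ())" if g: "g \<in> carrier G" for g
    proof -
      have "\<rho> g * \<rho> (inv\<^bsub>G\<^esub> g) = 1\<^sub>m n" "\<rho> (inv\<^bsub>G\<^esub> g) * \<rho> g = 1\<^sub>m n"
        using R g by (metis G.inv_closed G.r_inv, metis G.inv_closed G.l_inv)
      then show ?thesis using R g unfolding Units_def
        by (auto simp: ring_mat_simps intro!: bexI[of _ "\<rho> (inv\<^bsub>G\<^esub> g)"])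
    qed
    with R show ?L by (auto simp: representation_def hom_def units_of_def ring_mat_simps)
  }
qed

lemma representation_carrier:
  "representation G n \<rho> \<Longrightarrow> g \<in> carrier G \<Longrightarrow> \<rho> g \<in> carrier_mat n n"
  by (auto simp: representation_def hom_def units_of_def Units_def ring_mat_simps Pi_iff)

lemma representation_mult:
  "representation G n \<rho> \<Longrightarrow> g \<in> carrier G \<Longrightarrow> h \<in> carrier G \<Longrightarrow> \<rho> (g \<otimes>\<^bsub>G\<^esub> h) = \<rho> g * \<rho> h"
  by (auto simp: representation_def hom_def units_of_def ring_mat_simps)

lemma representation_one:
  "group G \<Longrightarrow> representation G n \<rho> \<Longrightarrow> \<rho> \<one>\<^bsub>G\<^esub> = 1\<^sub>m n"
  by (simp add: representation_iff)

lemma mat_trace_one: "mat_trace (1\<^sub>m n) = of_nat n"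
  by (simp add: mat_trace_def)

lemma mat_trace_smult: "mat_trace (c \<cdot>\<^sub>m A) = c * mat_trace A" if "A \<in> carrier_mat n n"
  using that by (simp add: mat_trace_def sum_distrib_left)

lemma mat_trace_mult:
  assumes "A \<in> carrier_mat n m" "B \<in> carrier_mat m n"
  shows "mat_trace (A * B) = (\<Sum>i<n. \<Sum>k<m. A $$ (i,k) * B $$ (k,i))"
  using assms by (simp add: mat_trace_def scalar_prod_def lessThan_atLeast0)

lemma mat_trace_mult_commute:
  assumes "A \<in> carrier_mat n m" "B \<in> carrier_mat m n"
  shows "mat_trace (A * B) = mat_trace (B * A)"
  unfolding mat_trace_mult[OF assms] mat_trace_mult[OF assms(2,1)]
  by (subst sum.swap) (simp add: mult.commute)

text \<open>An eigenspace of \<open>M\<close> is a nonzero invariant subspace, so it is everything.\<close>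

lemma schur_scalar:
  assumes irr: "irreducible_representation G n \<rho>"
    and M: "M \<in> carrier_mat n n"
    and comm: "\<And>g. g \<in> carrier G \<Longrightarrow> \<rho> g * M = M * \<rho> g"
  obtains c where "M = c \<cdot>\<^sub>m 1\<^sub>m n"
proof -
  interpret vec_space "TYPE(complex)" n .
  have rep: "representation G n \<rho>" using irr by (simp add: irreducible_representation_def)
  then have "0 < n" by (simp add: representation_def)
  from spectrum_non_empty[OF M this] obtain c v where ev: "eigenvector M v c"
    by (auto simp: spectrum_def eigenvalue_def)
  define W where "W = {w \<in> carrier_vec n. M *\<^sub>v w = c \<cdot>\<^sub>v w}"
  have v: "v \<in> W" "v \<noteq> 0\<^sub>v n" using ev M by (auto simp: eigenvector_def W_def)
  have "VectorSpace.subspace class_ring W (module_vec TYPE(complex) n)"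
    unfolding VectorSpace.subspace_def submodule_def
    using M mult_mat_vec[OF M] by (auto simp: W_def vectorspace_axioms module_axioms mult_add_distrib_mat_vec
        smult_add_distrib_vec smult_smult_assoc mult.commute module_vec_simps class_ring_simps)
  moreover have "\<rho> g *\<^sub>v w \<in> W" if g: "g \<in> carrier G" and w: "w \<in> W" for g w
  proof -
    note R = representation_carrier[OF rep g]
    have w': "w \<in> carrier_vec n" "M *\<^sub>v w = c \<cdot>\<^sub>v w" using w by (auto simp: W_def)
    have "M *\<^sub>v (\<rho> g *\<^sub>v w) = \<rho> g *\<^sub>v (M *\<^sub>v w)"
      using comm[OF g] R M w' by (metis assoc_mult_mat_vec)
    also have "\<dots> = c \<cdot>\<^sub>v (\<rho> g *\<^sub>v w)" using R w' by (simp add: mult_mat_vec)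
    finally show ?thesis using R w' by (simp add: W_def)
  qed
  ultimately have "W = {0\<^sub>v n} \<or> W = carrier_vec n"
    using irr by (auto simp: irreducible_representation_def)
  with v have W: "W = carrier_vec n" by auto
  have "M = c \<cdot>\<^sub>m 1\<^sub>m n"
  proof (rule eq_matI)
    fix i j assume "i < dim_row (c \<cdot>\<^sub>m 1\<^sub>m n)" "j < dim_col (c \<cdot>\<^sub>m 1\<^sub>m n)"
    then have ij: "i < n" "j < n" by auto
    have "unit_vec n j \<in> W" using W by simp
    then have "(M *\<^sub>v unit_vec n j) $ i = (c \<cdot>\<^sub>v unit_vec n j) $ i" by (simp add: W_def)
    then show "M $$ (i,j) = (c \<cdot>\<^sub>m 1\<^sub>m n) $$ (i,j)"
      using ij M by (auto simp: scalar_prod_right_unit)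
  qed (use M in auto)
  then show thesis by (rule that)
qed

text \<open>The average of \<open>\<rho> g * A * \<rho> (inv g)\<close> over the group commutes with the representation, so it is a
  scalar, and its trace \<open>mat_trace A\<close> tells which one. Multiplying by \<open>C\<close> and taking traces gives the
  identity. Different choices of \<open>A\<close> and \<open>C\<close> turn it into the norm of an irreducible character,
  the multiplicativity of central characters, and the description of pullbacks along
  homomorphisms.\<close>

lemma schur_trace:
  fixes G (structure)
  assumes G: "group G" and fin: "finite (carrier G)"
    and irr: "irreducible_representation G n \<rho>"
    and A: "A \<in> carrier_mat n n" and C: "C \<in> carrier_mat n n"
  shows "(\<Sum>g\<in>carrier G. mat_trace (C * (\<rho> g * A * \<rho> (inv g)))) =
    of_nat (card (carrier G)) * mat_trace A * mat_trace C / of_nat n"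
proof -
  interpret group G by fact
  have rep: "representation G n \<rho>" using irr by (simp add: irreducible_representation_def)
  then have n: "0 < n" by (simp add: representation_def)
  note R = representation_carrier[OF rep] and mult = representation_mult[OF rep]
  (* M is the sum of the conjugates X g, formed entry by entry; left and right say that
     multiplication distributes over this sum. *)
  define X where "X g = \<rho> g * A * \<rho> (inv g)" for g
  define M where "M = mat n n (\<lambda>(i,j). \<Sum>g\<in>carrier G. X g $$ (i,j))"
  have M: "M \<in> carrier_mat n n" by (simp add: M_def)
  have X: "X g \<in> carrier_mat n n" if "g \<in> carrier G" for g
    using R[OF that] R[OF inv_closed[OF that]] A by (simp add: X_def)
  have Xd: "dim_row (X g) = n" "dim_col (X g) = n" if "g \<in> carrier G" for g
    using X[OF that] by auto
  have left: "(D * M) $$ (i,j) = (\<Sum>g\<in>carrier G. (D * X g) $$ (i,j))"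
    if "D \<in> carrier_mat n n" "i < n" "j < n" for D i j
  proof -
    have "(D * M) $$ (i,j) = (\<Sum>k<n. \<Sum>g\<in>carrier G. D $$ (i,k) * X g $$ (k,j))"
      using that M by (simp add: M_def scalar_prod_def lessThan_atLeast0 sum_distrib_left)
    also have "\<dots> = (\<Sum>g\<in>carrier G. \<Sum>k<n. D $$ (i,k) * X g $$ (k,j))" by (rule sum.swap)
    also have "\<dots> = (\<Sum>g\<in>carrier G. (D * X g) $$ (i,j))"
      using that Xd by (intro sum.cong) (simp_all add: scalar_prod_def lessThan_atLeast0)
    finally show ?thesis .
  qed
  have right: "(M * D) $$ (i,j) = (\<Sum>g\<in>carrier G. (X g * D) $$ (i,j))"
    if "D \<in> carrier_mat n n" "i < n" "j < n" for D i j
  proof -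
    have "(M * D) $$ (i,j) = (\<Sum>k<n. \<Sum>g\<in>carrier G. X g $$ (i,k) * D $$ (k,j))"
      using that M by (simp add: M_def scalar_prod_def lessThan_atLeast0 sum_distrib_right)
    also have "\<dots> = (\<Sum>g\<in>carrier G. \<Sum>k<n. X g $$ (i,k) * D $$ (k,j))" by (rule sum.swap)
    also have "\<dots> = (\<Sum>g\<in>carrier G. (X g * D) $$ (i,j))"
      using that Xd by (intro sum.cong) (simp_all add: scalar_prod_def lessThan_atLeast0)
    finally show ?thesis .
  qed
  have shift: "\<rho> h * X g = X (h \<otimes> g) * \<rho> h" if h: "h \<in> carrier G" and g: "g \<in> carrier G" for h g
  proof -
    have "X (h \<otimes> g) * \<rho> h = (\<rho> h * \<rho> g * A) * (\<rho> (inv (h \<otimes> g)) * \<rho> h)"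
      unfolding X_def mult[OF h g] using h g A
      by (intro assoc_mult_mat[of _ n n _ n _ n] mult_carrier_mat[of _ n n _ n] R) simp_all
    also have "\<rho> (inv (h \<otimes> g)) * \<rho> h = \<rho> (inv g)"
      using h g by (subst mult[symmetric]) (auto simp: inv_mult_group m_assoc)
    also have "(\<rho> h * \<rho> g * A) * \<rho> (inv g) = \<rho> h * X g"
      unfolding X_def using R h g A by (simp add: assoc_mult_mat[of _ n n _ n _ n] mult_carrier_mat[of _ n n _ n])
    finally show ?thesis by simp
  qed
  have "\<rho> h * M = M * \<rho> h" if h: "h \<in> carrier G" for h
  proof (rule eq_matI)
    fix i j assume "i < dim_row (M * \<rho> h)" "j < dim_col (M * \<rho> h)"
    then have ij: "i < n" "j < n" using M R h by auto
    have "(\<rho> h * M) $$ (i,j) = (\<Sum>g\<in>carrier G. (X (h \<otimes> g) * \<rho> h) $$ (i,j))"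
      using left[OF R[OF h] ij] shift[OF h] by (simp cong: sum.cong)
    also have "\<dots> = (\<Sum>g\<in>carrier G. (X g * \<rho> h) $$ (i,j))"
      by (rule sum.reindex_bij_witness[where i = "\<lambda>g. inv h \<otimes> g" and j = "\<lambda>g. h \<otimes> g"])
        (use h in \<open>auto simp: m_assoc[symmetric]\<close>)
    also have "\<dots> = (M * \<rho> h) $$ (i,j)" using right[OF R[OF h] ij] by simp
    finally show "(\<rho> h * M) $$ (i,j) = (M * \<rho> h) $$ (i,j)" .
  qed (use M R h in auto)
  then obtain c where c: "M = c \<cdot>\<^sub>m 1\<^sub>m n" using schur_scalar[OF irr M] by blast
  have tr: "mat_trace (D * M) = (\<Sum>g\<in>carrier G. mat_trace (D * X g))" if D: "D \<in> carrier_mat n n" for D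
  proof -
    have "mat_trace (D * M) = (\<Sum>i<n. \<Sum>g\<in>carrier G. (D * X g) $$ (i,i))"
      unfolding mat_trace_def using D by (intro sum.cong left) auto
    also have "\<dots> = (\<Sum>g\<in>carrier G. \<Sum>i<n. (D * X g) $$ (i,i))" by (rule sum.swap)
    finally show ?thesis using D by (simp add: mat_trace_def)
  qed
  have trX: "mat_trace (X g) = mat_trace A" if g: "g \<in> carrier G" for g
  proof -
    have "mat_trace (X g) = mat_trace (\<rho> (inv g) * (\<rho> g * A))"
      unfolding X_def using g A
      by (intro mat_trace_mult_commute[of _ n n] mult_carrier_mat[of _ n n _ n] R) simp_all
    also have "\<rho> (inv g) * (\<rho> g * A) = \<rho> (inv g \<otimes> g) * A"
      using R g A by (subst mult) (simp_all add: assoc_mult_mat[of _ n n _ n _ n])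
    finally show ?thesis using g A representation_one[OF G rep] by simp
  qed
  have "mat_trace M = (\<Sum>g\<in>carrier G. mat_trace (X g))"
    using tr[of "1\<^sub>m n"] M by (simp add: left_mult_one_mat[OF X] cong: sum.cong)
  then have "c * of_nat n = of_nat (card (carrier G)) * mat_trace A"
    using trX c by (simp add: mat_trace_smult[of _ n] mat_trace_one)
  then have "c = of_nat (card (carrier G)) * mat_trace A / of_nat n"
    using n by (simp add: field_simps)
  moreover have "C * M = c \<cdot>\<^sub>m C" using c C mult_smult_distrib[of C n n "1\<^sub>m n" n c] by simp
  ultimately show ?thesis
    using tr[OF C] C by (simp add: X_def mat_trace_smult[of _ n])
qed

section \<open>Irreducible characters\<close>

lemma IrrE:
  assumes "\<chi> \<in> Irr G"
  obtains n \<rho> where "irreducible_representation G n \<rho>" "representation G n \<rho>" "0 < n"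
    "\<chi> = afforded_character G \<rho>" "\<And>g. g \<in> carrier G \<Longrightarrow> \<chi> g = mat_trace (\<rho> g)"
  using assms by (auto simp: Irr_def irreducible_representation_def representation_def afforded_character_def)

lemma afforded_character_one:
  "group G \<Longrightarrow> representation G n \<rho> \<Longrightarrow> afforded_character G \<rho> \<one>\<^bsub>G\<^esub> = of_nat n"
  by (simp add: afforded_character_def representation_one mat_trace_one group.is_monoid monoid.one_closed)

lemma Irr_one:
  assumes "group G" "\<chi> \<in> Irr G"
  obtains n where "0 < n" "\<chi> \<one>\<^bsub>G\<^esub> = of_nat n"
  using assms by (auto elim!: IrrE simp: afforded_character_one)

lemma Irr_eqI:
  assumes "\<chi> \<in> Irr G" "\<phi> \<in> Irr G" "\<And>g. g \<in> carrier G \<Longrightarrow> \<chi> g = \<phi> g"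
  shows "\<chi> = \<phi>"
  using assms by (auto elim!: IrrE simp: afforded_character_def intro!: restrict_ext)

lemma Irr_conj:
  fixes G (structure)
  assumes G: "group G" and \<chi>: "\<chi> \<in> Irr G" and x: "x \<in> carrier G" and g: "g \<in> carrier G"
  shows "\<chi> (x \<otimes> g \<otimes> inv x) = \<chi> g"
proof -
  interpret group G by fact
  from \<chi> obtain n \<rho> where rep: "representation G n \<rho>"
    and tr: "\<And>g. g \<in> carrier G \<Longrightarrow> \<chi> g = mat_trace (\<rho> g)" by (rule IrrE) blast
  note R = representation_carrier[OF rep] and mult = representation_mult[OF rep]
  have "mat_trace (\<rho> (x \<otimes> g) * \<rho> (inv x)) = mat_trace (\<rho> (inv x) * \<rho> (x \<otimes> g))"
    using R x g by (intro mat_trace_mult_commute[of _ n n]) auto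
  then show ?thesis using x g by (simp add: tr mult[symmetric] m_assoc[symmetric])
qed

text \<open>After division by \<open>\<chi> \<one>\<close>, an irreducible character is multiplicative up to averaging its second
  factor over conjugates: take \<open>A = \<rho> b\<close> and \<open>C = \<rho> a\<close> in the averaged trace.\<close>

lemma Irr_product_formula:
  fixes G (structure)
  assumes G: "group G" and fin: "finite (carrier G)" and \<chi>: "\<chi> \<in> Irr G"
    and a: "a \<in> carrier G" and b: "b \<in> carrier G"
  shows "\<chi> \<one> * (\<Sum>x\<in>carrier G. \<chi> (a \<otimes> (x \<otimes> b \<otimes> inv x))) = of_nat (card (carrier G)) * \<chi> a * \<chi> b"
proof -
  interpret group G by fact
  from \<chi> obtain n \<rho> where irr: "irreducible_representation G n \<rho>" and rep: "representation G n \<rho>"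
    and n: "0 < n" and aff: "\<chi> = afforded_character G \<rho>"
    and tr: "\<And>g. g \<in> carrier G \<Longrightarrow> \<chi> g = mat_trace (\<rho> g)" by (rule IrrE) blast
  note R = representation_carrier[OF rep] and mult = representation_mult[OF rep]
  have "(\<Sum>x\<in>carrier G. \<chi> (a \<otimes> (x \<otimes> b \<otimes> inv x))) =
      (\<Sum>x\<in>carrier G. mat_trace (\<rho> a * (\<rho> x * \<rho> b * \<rho> (inv x))))"
    using a b by (intro sum.cong) (simp_all add: tr mult)
  also have "\<dots> = of_nat (card (carrier G)) * \<chi> b * \<chi> a / of_nat n"
    using schur_trace[OF G fin irr R[OF b] R[OF a]] a b by (simp add: tr)
  finally show ?thesis
    using n afforded_character_one[OF G rep] aff by simp
qed

text \<open>Take matrix units for \<open>A\<close> and \<open>C\<close> in the averaged trace; this gives Schur's orthogonality of the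
  diagonal matrix entries, which are then summed. Here \<open>\<chi> (inv g)\<close> is the
  complex conjugate of \<open>\<chi> g\<close>.\<close>

lemma Irr_norm:
  fixes G (structure)
  assumes G: "group G" and fin: "finite (carrier G)" and \<chi>: "\<chi> \<in> Irr G"
  shows "(\<Sum>g\<in>carrier G. \<chi> g * \<chi> (inv g)) = of_nat (card (carrier G))"
proof -
  interpret group G by fact
  from \<chi> obtain n \<rho> where irr: "irreducible_representation G n \<rho>" and rep: "representation G n \<rho>"
    and n: "0 < n" and tr: "\<And>g. g \<in> carrier G \<Longrightarrow> \<chi> g = mat_trace (\<rho> g)" by (rule IrrE) blast
  note R = representation_carrier[OF rep]
  define E where "E i k = mat n n (\<lambda>(a,b). if a = i \<and> b = k then 1 else (0::complex))" for i k
  have E: "E i k \<in> carrier_mat n n" for i k by (simp add: E_def)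
  have trE: "mat_trace (E i k) = (if i = k then 1 else 0)" if "i < n" for i k
    using that by (auto simp: mat_trace_def E_def)
  have trEX: "mat_trace (E k i * X) = X $$ (i,k)" if "X \<in> carrier_mat n n" "i < n" "k < n" for X i k
  proof -
    have "(\<Sum>b<n. E k i $$ (a,b) * X $$ (b,a)) = (if a = k then X $$ (i,k) else 0)" if "a < n" for a
      using that \<open>i < n\<close> by (cases "a = k") (simp_all add: E_def if_distrib[of "\<lambda>c. c * _"] cong: if_cong)
    then show ?thesis using \<open>k < n\<close> by (simp add: mat_trace_mult[OF E that(1)])
  qed
  have XEY: "(X * E i k * Y) $$ (i,k) = X $$ (i,i) * Y $$ (k,k)"
    if "X \<in> carrier_mat n n" "Y \<in> carrier_mat n n" "i < n" "k < n" for X Y i k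
  proof -
    define Z where "Z = X * E i k"
    have Z: "Z \<in> carrier_mat n n" using that(1) E by (simp add: Z_def)
    have "Z $$ (i,b) = (if b = k then X $$ (i,i) else 0)" if "b < n" for b
      using \<open>X \<in> _\<close> \<open>i < n\<close> that
      by (cases "b = k") (simp_all add: Z_def E_def scalar_prod_def if_distrib[of "\<lambda>c. _ * c"] cong: if_cong)
    then have "(Z * Y) $$ (i,k) = X $$ (i,i) * Y $$ (k,k)" using that Z
      by (simp add: scalar_prod_def if_distrib[of "\<lambda>c. c * _"] cong: if_cong)
    then show ?thesis by (simp add: Z_def)
  qed
  have entry: "(\<Sum>g\<in>carrier G. \<rho> g $$ (i,i) * \<rho> (inv g) $$ (k,k)) =
      (if i = k then of_nat (card (carrier G)) / of_nat n else 0)" if "i < n" "k < n" for i k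
  proof -
    have "(\<Sum>g\<in>carrier G. \<rho> g $$ (i,i) * \<rho> (inv g) $$ (k,k)) =
        (\<Sum>g\<in>carrier G. mat_trace (E k i * (\<rho> g * E i k * \<rho> (inv g))))"
    proof (intro sum.cong refl)
      fix g assume g: "g \<in> carrier G"
      have "\<rho> g * E i k * \<rho> (inv g) \<in> carrier_mat n n"
        using g by (intro mult_carrier_mat[of _ n n _ n] R E) simp_all
      then show "\<rho> g $$ (i,i) * \<rho> (inv g) $$ (k,k) = mat_trace (E k i * (\<rho> g * E i k * \<rho> (inv g)))"
        using that g by (simp only: trEX XEY R inv_closed)
    qed
    then show ?thesis using schur_trace[OF G fin irr E E] that by (simp add: trE)
  qed
  have "(\<Sum>g\<in>carrier G. \<chi> g * \<chi> (inv g)) =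
      (\<Sum>g\<in>carrier G. \<Sum>i<n. \<Sum>k<n. \<rho> g $$ (i,i) * \<rho> (inv g) $$ (k,k))"
    by (intro sum.cong refl) (simp add: tr mat_trace_def sum_product carrier_matD(1)[OF R])
  also have "\<dots> = (\<Sum>i<n. \<Sum>g\<in>carrier G. \<Sum>k<n. \<rho> g $$ (i,i) * \<rho> (inv g) $$ (k,k))"
    by (rule sum.swap)
  also have "\<dots> = (\<Sum>i<n. \<Sum>k<n. \<Sum>g\<in>carrier G. \<rho> g $$ (i,i) * \<rho> (inv g) $$ (k,k))"
    by (intro sum.cong refl sum.swap)
  also have "\<dots> = (\<Sum>i<n. \<Sum>k<n. if i = k then of_nat (card (carrier G)) / of_nat n else 0)"
    by (intro sum.cong refl entry) auto
  also have "\<dots> = of_nat (card (carrier G))" using n by simp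
  finally show ?thesis .
qed

text \<open>Both characters have norm 1, so the factor of proportionality has square 1, and it is positive
  as a quotient of degrees.\<close>

lemma Irr_proportional_eq:
  fixes G (structure)
  assumes G: "group G" and fin: "finite (carrier G)" and \<chi>: "\<chi> \<in> Irr G" and \<phi>: "\<phi> \<in> Irr G"
    and proportional: "\<And>g. g \<in> carrier G \<Longrightarrow> \<chi> g * \<phi> \<one> = \<phi> g * \<chi> \<one>"
  shows "\<chi> = \<phi>"
proof -
  interpret group G by fact
  obtain n where n: "0 < n" "\<chi> \<one> = of_nat n" using Irr_one[OF G \<chi>] .
  obtain m where m: "0 < m" "\<phi> \<one> = of_nat m" using Irr_one[OF G \<phi>] .
  have scale: "(\<Sum>g\<in>carrier G. (\<psi> g * c) * (\<psi> (inv g) * c)) = (\<Sum>g\<in>carrier G. \<psi> g * \<psi> (inv g)) * c\<^sup>2"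
    for \<psi> :: "'a \<Rightarrow> complex" and c
    by (simp add: power2_eq_square mult_ac flip: sum_distrib_left)
  have "(\<Sum>g\<in>carrier G. (\<chi> g * \<phi> \<one>) * (\<chi> (inv g) * \<phi> \<one>)) =
      (\<Sum>g\<in>carrier G. (\<phi> g * \<chi> \<one>) * (\<phi> (inv g) * \<chi> \<one>))"
    using proportional by (intro sum.cong refl) simp
  then have "(\<Sum>g\<in>carrier G. \<chi> g * \<chi> (inv g)) * (\<phi> \<one>)\<^sup>2 =
      (\<Sum>g\<in>carrier G. \<phi> g * \<phi> (inv g)) * (\<chi> \<one>)\<^sup>2"
    by (simp only: scale)
  then have "of_nat (card (carrier G)) * (of_nat m)\<^sup>2 = of_nat (card (carrier G)) * (of_nat n :: complex)\<^sup>2"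
    unfolding Irr_norm[OF G fin \<chi>] Irr_norm[OF G fin \<phi>] n m .
  then have "of_nat (m\<^sup>2) = (of_nat (n\<^sup>2) :: complex)"
    using fin by (auto simp: card_gt_0_iff)
  then have "m = n" by (simp only: of_nat_eq_iff power2_eq_iff_nonneg)
  then show ?thesis using proportional n m by (intro Irr_eqI[OF \<chi> \<phi>]) auto
qed

text \<open>Here \<open>P\<close> is the embedding of an irreducible subrepresentation \<open>\<sigma>\<close> and \<open>Q\<close> a linear (not
  necessarily equivariant) retraction onto it. As long as the representation is reducible, one
  replaces it by its restriction to a proper invariant subspace.\<close>

lemma irreducible_subrepresentation:
  assumes A: "group A" and "representation A n \<rho>"
  obtains m \<sigma> P Q where "irreducible_representation A m \<sigma>" "P \<in> carrier_mat n m"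
    "Q \<in> carrier_mat m n" "Q * P = 1\<^sub>m m" "\<And>a. a \<in> carrier A \<Longrightarrow> \<rho> a * P = P * \<sigma> a"
proof -
  have "\<exists>m \<sigma> P Q. irreducible_representation A m \<sigma> \<and> P \<in> carrier_mat n m \<and>
      Q \<in> carrier_mat m n \<and> Q * P = 1\<^sub>m m \<and> (\<forall>a\<in>carrier A. \<rho> a * P = P * \<sigma> a)"
    using assms(2)
  proof (induction n arbitrary: \<rho> rule: less_induct)
    case (less n)
    note rep = less.prems
    note R = representation_carrier[OF rep]
    show ?case
    proof (cases "irreducible_representation A n \<rho>")
      case True
      then show ?thesis using left_mult_one_mat[OF R] right_mult_one_mat[OF R]
        by (intro exI[of _ n] exI[of _ \<rho>] exI[of _ "1\<^sub>m n"] conjI) auto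
    next
      case False
      then obtain W where W: "VectorSpace.subspace class_ring W (module_vec TYPE(complex) n)"
        and inv: "\<And>g w. g \<in> carrier A \<Longrightarrow> w \<in> W \<Longrightarrow> \<rho> g *\<^sub>v w \<in> W"
        and proper: "W \<noteq> {0\<^sub>v n}" "W \<noteq> carrier_vec n"
        using rep by (auto simp: irreducible_representation_def)
      obtain m P Q where m: "0 < m" "m < n" and P: "P \<in> carrier_mat n m" and Q: "Q \<in> carrier_mat m n"
        and QP: "Q * P = 1\<^sub>m m" and colP: "\<And>j. j < m \<Longrightarrow> col P j \<in> W"
        and PQ: "\<And>w. w \<in> W \<Longrightarrow> P *\<^sub>v (Q *\<^sub>v w) = w"
        using subspace_retraction[OF W proper] by metis
      (* The restriction of the representation to W, in the coordinates given by P. *)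
      define \<sigma> where "\<sigma> a = Q * (\<rho> a * P)" for a
      have S: "\<sigma> a \<in> carrier_mat m m" if "a \<in> carrier A" for a
        using R[OF that] P Q by (simp add: \<sigma>_def)
      have inter: "\<rho> a * P = P * \<sigma> a" if a: "a \<in> carrier A" for a
      proof (rule mat_col_eqI)
        fix j assume "j < dim_col (P * \<sigma> a)"
        then have j: "j < m" using S[OF a] by simp
        have c: "col P j \<in> carrier_vec n" using P by auto
        have RP: "\<rho> a * P \<in> carrier_mat n m" and QRP: "Q * (\<rho> a * P) \<in> carrier_mat m m"
          using R[OF a] P Q by auto
        have "col (P * \<sigma> a) j = P *\<^sub>v (Q *\<^sub>v (\<rho> a *\<^sub>v col P j))"
          unfolding \<sigma>_def col_mult2[OF P QRP j] col_mult2[OF Q RP j] col_mult2[OF R[OF a] P j] ..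
        also have "\<dots> = \<rho> a *\<^sub>v col P j" by (intro PQ inv a colP j)
        also have "\<dots> = col (\<rho> a * P) j" by (rule col_mult2[OF R[OF a] P j, symmetric])
        finally show "col (\<rho> a * P) j = col (P * \<sigma> a) j" by simp
      qed (use R[OF a] P S[OF a] in auto)
      have "\<sigma> (a \<otimes>\<^bsub>A\<^esub> b) = \<sigma> a * \<sigma> b" if a: "a \<in> carrier A" and b: "b \<in> carrier A" for a b
      proof -
        have "\<sigma> (a \<otimes>\<^bsub>A\<^esub> b) = Q * (\<rho> a * (\<rho> b * P))"
          unfolding \<sigma>_def representation_mult[OF rep a b]
          using R[OF a] R[OF b] P by (simp add: assoc_mult_mat[of _ n n _ n _ m])
        also have "\<rho> a * (\<rho> b * P) = \<rho> a * P * \<sigma> b"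
          unfolding inter[OF b] using R[OF a] P S[OF b] by (simp add: assoc_mult_mat[of _ n n _ m _ m])
        also have "Q * (\<rho> a * P * \<sigma> b) = \<sigma> a * \<sigma> b"
          unfolding \<sigma>_def[of a] using R[OF a] P Q S[OF b] by (simp add: assoc_mult_mat[of _ m n _ m _ m])
        finally show ?thesis .
      qed
      then have "representation A m \<sigma>"
        using m S P QP representation_one[OF A rep] by (simp add: representation_iff[OF A] \<sigma>_def)
      from less.IH[OF m(2) this] obtain k \<tau> P' Q' where irr: "irreducible_representation A k \<tau>"
        and P': "P' \<in> carrier_mat m k" and Q': "Q' \<in> carrier_mat k m" and QP': "Q' * P' = 1\<^sub>m k"
        and inter': "\<And>a. a \<in> carrier A \<Longrightarrow> \<sigma> a * P' = P' * \<tau> a" by blast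
      have "(Q' * Q) * (P * P') = 1\<^sub>m k"
      proof -
        have "(Q' * Q) * (P * P') = Q' * ((Q * P) * P')"
          unfolding assoc_mult_mat[OF Q P P'] by (rule assoc_mult_mat[OF Q' Q mult_carrier_mat[OF P P']])
        then show ?thesis using QP QP' P' by simp
      qed
      moreover have "\<rho> a * (P * P') = (P * P') * \<tau> a" if a: "a \<in> carrier A" for a
      proof -
        have T: "\<tau> a \<in> carrier_mat k k"
          using irr a representation_carrier by (auto simp: irreducible_representation_def)
        have "\<rho> a * (P * P') = P * \<sigma> a * P'"
          using R[OF a] P P' by (simp add: inter[OF a, symmetric] assoc_mult_mat[of _ n n _ m _ k])
        also have "\<dots> = P * P' * \<tau> a"
          using P P' S[OF a] T by (simp add: assoc_mult_mat[of _ n m _ _ _ k] inter'[OF a])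
        finally show ?thesis .
      qed
      ultimately show ?thesis using irr P Q P' Q'
        by (intro exI[of _ k] exI[of _ \<tau>] exI[of _ "P * P'"] exI[of _ "Q' * Q"]) auto
    qed
  qed
  then show thesis using that by blast
qed

text \<open>The hypothesis on \<open>f\<close> says that every conjugate of \<open>f a\<close> in \<open>G\<close> is already the image of a
  conjugate of \<open>a\<close> in \<open>A\<close>. It holds for surjections and for the inclusion of a factor of a direct
  product. By Schur's lemma the average of \<open>\<rho> (f a)\<close> over the conjugates is the scalar
  \<open>\<chi> (f a) / \<chi> \<one>\<close>. On an irreducible \<open>A\<close>-invariant subspace with character \<open>\<theta>\<close> all the averaged
  matrices have the same trace \<open>\<theta> a\<close>, so that the scalar is also \<open>\<theta> a / \<theta> \<one>\<close>.\<close>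

lemma Irr_pullback_multiple:
  fixes G (structure)
  assumes G: "group G" and fin: "finite (carrier G)" and A: "group A" and f: "f \<in> hom A G"
    and conj: "\<And>g a. g \<in> carrier G \<Longrightarrow> a \<in> carrier A \<Longrightarrow>
      \<exists>b\<in>carrier A. g \<otimes> f a \<otimes> inv g = f (b \<otimes>\<^bsub>A\<^esub> a \<otimes>\<^bsub>A\<^esub> inv\<^bsub>A\<^esub> b)"
    and \<chi>: "\<chi> \<in> Irr G"
  obtains \<theta> where "\<theta> \<in> Irr A" "\<And>a. a \<in> carrier A \<Longrightarrow> \<chi> (f a) * \<theta> \<one>\<^bsub>A\<^esub> = \<theta> a * \<chi> \<one>"
proof -
  interpret group G by fact
  interpret A: group A by fact
  interpret f: group_hom A G f using f by unfold_locales
  from \<chi> obtain n \<rho> where irr: "irreducible_representation G n \<rho>" and rep: "representation G n \<rho>"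
    and n: "0 < n" and aff: "\<chi> = afforded_character G \<rho>"
    and tr: "\<And>g. g \<in> carrier G \<Longrightarrow> \<chi> g = mat_trace (\<rho> g)" by (rule IrrE) blast
  note R = representation_carrier[OF rep] and mult = representation_mult[OF rep]
  have "representation A n (\<rho> \<circ> f)"
    using rep by (simp add: representation_iff[OF A] representation_iff[OF G])
  from irreducible_subrepresentation[OF A this, unfolded o_def] obtain m \<sigma> P Q
    where irr': "irreducible_representation A m \<sigma>" and P: "P \<in> carrier_mat n m"
      and Q: "Q \<in> carrier_mat m n" and QP: "Q * P = 1\<^sub>m m"
      and inter: "\<And>a. a \<in> carrier A \<Longrightarrow> \<rho> (f a) * P = P * \<sigma> a" by blast
  have rep': "representation A m \<sigma>" using irr' by (simp add: irreducible_representation_def)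
  define \<theta> where "\<theta> = afforded_character A \<sigma>"
  have \<theta>: "\<theta> \<in> Irr A" using irr' by (auto simp: Irr_def \<theta>_def)
  have trPQ: "mat_trace (P * Q * \<rho> (f a)) = \<theta> a" if a: "a \<in> carrier A" for a
  proof -
    have S: "\<sigma> a \<in> carrier_mat m m" using representation_carrier[OF rep' a] .
    have Rf: "\<rho> (f a) \<in> carrier_mat n n" using R a by simp
    have "mat_trace (P * Q * \<rho> (f a)) = mat_trace (\<rho> (f a) * (P * Q))"
      using P Q Rf by (intro mat_trace_mult_commute[of _ n n]) auto
    also have "\<rho> (f a) * (P * Q) = P * (\<sigma> a * Q)"
      using P Q Rf S by (simp add: assoc_mult_mat[of _ n n _ m _ n, symmetric] inter[OF a])
    also have "mat_trace (P * (\<sigma> a * Q)) = mat_trace (\<sigma> a * Q * P)"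
      using P Q S by (intro mat_trace_mult_commute[of _ n m]) auto
    also have "\<sigma> a * Q * P = \<sigma> a" using P Q S QP by (simp add: assoc_mult_mat[of _ m m _ n _ m])
    finally show ?thesis using a by (simp add: \<theta>_def afforded_character_def)
  qed
  show thesis
  proof (rule that[OF \<theta>])
    fix a assume a: "a \<in> carrier A"
    (* P * Q projects onto the subspace that carries theta. *)
    have term_eq: "mat_trace (P * Q * (\<rho> g * \<rho> (f a) * \<rho> (inv g))) = \<theta> a" if g: "g \<in> carrier G" for g
    proof -
      obtain b where b: "b \<in> carrier A" "g \<otimes> f a \<otimes> inv g = f (b \<otimes>\<^bsub>A\<^esub> a \<otimes>\<^bsub>A\<^esub> inv\<^bsub>A\<^esub> b)"
        using conj[OF g a] by blast
      have "\<rho> g * \<rho> (f a) * \<rho> (inv g) = \<rho> (f (b \<otimes>\<^bsub>A\<^esub> a \<otimes>\<^bsub>A\<^esub> inv\<^bsub>A\<^esub> b))"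
        using g a by (simp add: mult[symmetric] b(2))
      moreover have "mat_trace (P * Q * \<rho> (f (b \<otimes>\<^bsub>A\<^esub> a \<otimes>\<^bsub>A\<^esub> inv\<^bsub>A\<^esub> b))) = \<theta> a"
        using trPQ[of "b \<otimes>\<^bsub>A\<^esub> a \<otimes>\<^bsub>A\<^esub> inv\<^bsub>A\<^esub> b"] a b(1) Irr_conj[OF A \<theta> b(1) a]
        by (simp del: f.hom_mult)
      ultimately show ?thesis by (simp only:)
    qed
    have PQ: "P * Q \<in> carrier_mat n n" and fa: "f a \<in> carrier G" using P Q a by auto
    have "mat_trace (P * Q) = of_nat m"
      using mat_trace_mult_commute[OF P Q] QP by (simp add: mat_trace_one)
    then have "of_nat (card (carrier G)) * \<theta> a = of_nat (card (carrier G)) * \<chi> (f a) * of_nat m / of_nat n"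
      using schur_trace[OF G fin irr R[OF fa] PQ] a fa by (simp add: term_eq tr)
    then have "\<theta> a * of_nat n = \<chi> (f a) * of_nat m"
      using n fin by (auto simp: card_gt_0_iff field_simps)
    then show "\<chi> (f a) * \<theta> \<one>\<^bsub>A\<^esub> = \<theta> a * \<chi> \<one>"
      using afforded_character_one[OF G rep] afforded_character_one[OF A rep'] aff
      by (simp add: \<theta>_def)
  qed
qed

section \<open>Linear characters and induction\<close>

lemma linear_character_iff:
  fixes K (structure)
  assumes K: "group K"
  shows "linear_character K \<mu> \<longleftrightarrow> \<mu> \<in> extensional (carrier K) \<and> \<mu> \<one> = 1 \<and>
    (\<forall>x\<in>carrier K. \<forall>y\<in>carrier K. \<mu> (x \<otimes> y) = \<mu> x * \<mu> y)" (is "?L \<longleftrightarrow> ?R")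
proof
  interpret group K by fact
  {
    assume ?L
    then obtain n \<rho> where rep: "representation K n \<rho>" and \<mu>: "\<mu> = afforded_character K \<rho>"
      and one: "\<mu> \<one> = 1"
      by (auto simp: linear_character_def is_character_def)
    have n: "n = 1" using one afforded_character_one[OF K rep] \<mu> by simp
    note R = representation_carrier[OF rep, unfolded n]
    have "\<mu> x = \<rho> x $$ (0,0)" if "x \<in> carrier K" for x
      using that R[OF that] by (simp add: \<mu> afforded_character_def mat_trace_def)
    moreover have "\<rho> (x \<otimes> y) $$ (0,0) = \<rho> x $$ (0,0) * \<rho> y $$ (0,0)"
      if "x \<in> carrier K" "y \<in> carrier K" for x y
      using R[OF that(1)] R[OF that(2)]
      by (simp add: representation_mult[OF rep that] scalar_prod_def)
    ultimately show ?R using one by (simp add: \<mu> afforded_character_def)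
  next
    assume R: ?R
    define \<rho> where "\<rho> g = mat 1 1 (\<lambda>_. \<mu> g)" for g
    have "representation K 1 \<rho>"
      unfolding representation_iff[OF K] using R by (auto simp: \<rho>_def scalar_prod_def intro!: eq_matI)
    moreover have "\<mu> = afforded_character K \<rho>"
      using R by (auto simp: afforded_character_def \<rho>_def mat_trace_def fun_eq_iff extensional_def)
    ultimately show ?L using R by (auto simp: linear_character_def is_character_def)
  }
qed

text \<open>Frobenius reciprocity: the inner product with an induced character is the inner product of the
  restriction, because \<open>\<chi>\<close> is constant on conjugacy classes.\<close>

lemma char_inner_induced:
  fixes G (structure)
  assumes G: "group G" and fin: "finite (carrier G)" and H: "H \<subseteq> carrier G" and \<chi>: "\<chi> \<in> Irr G"
  shows "char_inner G \<chi> (induced_character G H \<mu>) = (\<Sum>h\<in>H. \<chi> h * cnj (\<mu> h)) / of_nat (card H)"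
proof -
  interpret group G by fact
  define F where "F y = (if y \<in> H then \<chi> y * cnj (\<mu> y) else 0)" for y
  have S: "(\<Sum>y\<in>carrier G. F y) = (\<Sum>h\<in>H. \<chi> h * cnj (\<mu> h))"
    unfolding F_def using H fin by (simp add: sum.If_cases Int_commute inf.absorb1)
  have "(\<Sum>g\<in>carrier G. \<chi> g * cnj (induced_character G H \<mu> g)) =
      (\<Sum>g\<in>carrier G. \<Sum>x\<in>carrier G. F (x \<otimes> g \<otimes> inv x)) / of_nat (card H)"
    by (auto simp: induced_character_def F_def Let_def sum_distrib_left sum_divide_distrib Irr_conj[OF G \<chi>]
        intro!: sum.cong)
  also have "(\<Sum>g\<in>carrier G. \<Sum>x\<in>carrier G. F (x \<otimes> g \<otimes> inv x)) =
      (\<Sum>x\<in>carrier G. \<Sum>g\<in>carrier G. F (x \<otimes> g \<otimes> inv x))" by (rule sum.swap)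
  also have "\<dots> = (\<Sum>x\<in>carrier G. \<Sum>y\<in>carrier G. F y)"
  proof (rule sum.cong)
    fix x assume x: "x \<in> carrier G"
    show "(\<Sum>g\<in>carrier G. F (x \<otimes> g \<otimes> inv x)) = (\<Sum>y\<in>carrier G. F y)"
      by (rule sum.reindex_bij_witness[where i = "\<lambda>y. inv x \<otimes> y \<otimes> x" and j = "\<lambda>g. x \<otimes> g \<otimes> inv x"])
        (use x in \<open>simp_all add: m_assoc\<close>, (simp_all add: m_assoc[symmetric])?)
  qed simp
  finally show ?thesis
    using fin by (auto simp: char_inner_def S card_gt_0_iff)
qed

text \<open>Averages over a group and over its homomorphic image agree, all fibres having the size of the
  kernel.\<close>

lemma sum_hom_image:
  fixes F :: "'b \<Rightarrow> complex"
  assumes "group_hom K G f" and fin: "finite (carrier K)"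
  shows "(\<Sum>k\<in>carrier K. F (f k)) / of_nat (card (carrier K)) =
    (\<Sum>y\<in>f ` carrier K. F y) / of_nat (card (f ` carrier K))"
proof -
  interpret group_hom K G f by fact
  define d where "d = card (kernel K G f)"
  have fibre: "card {k \<in> carrier K. f k = y} = d" if "y \<in> f ` carrier K" for y
  proof -
    from that obtain z where z: "z \<in> carrier K" "y = f z" by auto
    have "bij_betw (\<lambda>k. k \<otimes>\<^bsub>K\<^esub> inv\<^bsub>K\<^esub> z) {k \<in> carrier K. f k = y} (kernel K G f)"
      by (rule bij_betw_byWitness[where f' = "\<lambda>k. k \<otimes>\<^bsub>K\<^esub> z"])
        (use z in \<open>auto simp: kernel_def G.m_assoc\<close>)
    then show ?thesis by (simp add: d_def bij_betw_same_card)
  qed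
  have gen: "(\<Sum>k\<in>carrier K. E (f k)) = of_nat d * (\<Sum>y\<in>f ` carrier K. E y)" for E :: "'b \<Rightarrow> complex"
  proof -
    have "(\<Sum>k\<in>carrier K. E (f k)) = (\<Sum>y\<in>f ` carrier K. \<Sum>k | k \<in> carrier K \<and> f k = y. E (f k))"
      by (rule sum.image_gen[OF fin])
    also have "\<dots> = (\<Sum>y\<in>f ` carrier K. of_nat d * E y)"
      by (intro sum.cong refl) (simp add: fibre[symmetric])
    finally show ?thesis by (simp add: sum_distrib_left)
  qed
  have "d > 0" using fin by (auto simp: d_def card_gt_0_iff kernel_def intro!: exI[of _ "\<one>\<^bsub>K\<^esub>"])
  then show ?thesis using gen[of F] gen[of "\<lambda>_. 1"] by simp
qed

lemma linear_character_factors: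
  assumes "group_hom K G f" and \<mu>: "linear_character K \<mu>"
    and ker: "\<And>k. k \<in> carrier K \<Longrightarrow> f k = \<one>\<^bsub>G\<^esub> \<Longrightarrow> \<mu> k = 1"
  obtains \<nu> where "linear_character (G\<lparr>carrier := f ` carrier K\<rparr>) \<nu>"
    "\<And>k. k \<in> carrier K \<Longrightarrow> \<nu> (f k) = \<mu> k"
proof -
  interpret group_hom K G f by fact
  from \<mu> have mult: "\<And>x y. x \<in> carrier K \<Longrightarrow> y \<in> carrier K \<Longrightarrow> \<mu> (x \<otimes>\<^bsub>K\<^esub> y) = \<mu> x * \<mu> y"
    and one: "\<mu> \<one>\<^bsub>K\<^esub> = 1"
    unfolding linear_character_iff[OF G.is_group] by auto
  have eq: "\<mu> k = \<mu> k'" if k: "k \<in> carrier K" "k' \<in> carrier K" "f k = f k'" for k k'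
  proof -
    have "\<mu> (k \<otimes>\<^bsub>K\<^esub> inv\<^bsub>K\<^esub> k') = 1" using k by (intro ker) auto
    then have "\<mu> (k \<otimes>\<^bsub>K\<^esub> inv\<^bsub>K\<^esub> k' \<otimes>\<^bsub>K\<^esub> k') = \<mu> k'" using k by (subst mult) auto
    then show ?thesis using k by (simp add: G.m_assoc)
  qed
  define \<nu> where "\<nu> = (\<lambda>y\<in>f ` carrier K. \<mu> (inv_into (carrier K) f y))"
  have \<nu>: "\<nu> (f k) = \<mu> k" if "k \<in> carrier K" for k
  proof -
    have "inv_into (carrier K) f (f k) \<in> carrier K" "f (inv_into (carrier K) f (f k)) = f k"
      using that by (auto intro: inv_into_into f_inv_into_f)
    then have "\<mu> (inv_into (carrier K) f (f k)) = \<mu> k" using that by (intro eq)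
    then show ?thesis using that by (simp add: \<nu>_def)
  qed
  have "group (G\<lparr>carrier := f ` carrier K\<rparr>)"
    using img_is_subgroup H.subgroup_imp_group by blast
  moreover have "\<nu> \<one>\<^bsub>G\<^esub> = 1" using \<nu>[of "\<one>\<^bsub>K\<^esub>"] one by simp
  moreover have "\<nu> (f x \<otimes>\<^bsub>G\<^esub> f y) = \<nu> (f x) * \<nu> (f y)" if "x \<in> carrier K" "y \<in> carrier K" for x y
    using \<nu>[of "x \<otimes>\<^bsub>K\<^esub> y"] that by (simp add: \<nu> mult)
  ultimately have "linear_character (G\<lparr>carrier := f ` carrier K\<rparr>) \<nu>"
    by (subst linear_character_iff) (auto simp: \<nu>_def)
  then show thesis using \<nu> by (rule that)
qed

section \<open>Separation by induced linear characters\<close>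

text \<open>The defining condition of both classes of groups, with the kind of subgroup as a parameter, so
  that normal and subnormal subgroups can be treated together.\<close>

definition separates_characters :: "('a, 'b) monoid_scheme \<Rightarrow> ('a set \<Rightarrow> bool) \<Rightarrow> bool" where
  "separates_characters G S \<longleftrightarrow> (\<forall>\<chi>\<in>Irr G. \<forall>\<phi>\<in>Irr G. \<chi> \<noteq> \<phi> \<longrightarrow>
     (\<exists>H \<mu>. S H \<and> linear_character (G\<lparr>carrier := H\<rparr>) \<mu> \<and>
        \<chi> \<in> Cons G (induced_character G H \<mu>) \<and> \<phi> \<notin> Cons G (induced_character G H \<mu>)))"

text \<open>The pullbacks of \<open>\<chi>\<close> and \<open>\<phi>\<close> along \<open>f\<close> are positive multiples of irreducible characters
  \<open>\<theta> \<noteq> \<eta>\<close> of \<open>A\<close>. Let \<open>\<mu>\<close> on \<open>H\<close> separate these. Since the pullback of \<open>\<chi>\<close> is invariant under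
  translation by the kernel of \<open>f\<close>, its inner product with \<open>\<mu>\<close> could not be nonzero unless \<open>\<mu>\<close> is
  trivial on \<open>H \<inter> ker f\<close>. Therefore \<open>\<mu>\<close> descends to a linear character \<open>\<nu>\<close> of \<open>f ` H\<close>, and by
  Frobenius reciprocity the inner products with its induction are positive multiples of those
  in \<open>A\<close>.\<close>

lemma separate_by_pushforward:
  fixes G (structure)
  assumes G: "group G" and fin: "finite (carrier G)" and A: "group A" and finA: "finite (carrier A)"
    and f: "f \<in> hom A G"
    and conj: "\<And>g a. g \<in> carrier G \<Longrightarrow> a \<in> carrier A \<Longrightarrow>
      \<exists>b\<in>carrier A. g \<otimes> f a \<otimes> inv g = f (b \<otimes>\<^bsub>A\<^esub> a \<otimes>\<^bsub>A\<^esub> inv\<^bsub>A\<^esub> b)"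
    and sep: "separates_characters A S" and sub: "\<And>H. S H \<Longrightarrow> subgroup H A"
    and \<chi>: "\<chi> \<in> Irr G" and \<phi>: "\<phi> \<in> Irr G"
    and a: "a \<in> carrier A" "\<chi> (f a) * \<phi> \<one> \<noteq> \<phi> (f a) * \<chi> \<one>"
  shows "\<exists>H \<nu>. S H \<and> linear_character (G\<lparr>carrier := f ` H\<rparr>) \<nu> \<and>
    \<chi> \<in> Cons G (induced_character G (f ` H) \<nu>) \<and> \<phi> \<notin> Cons G (induced_character G (f ` H) \<nu>)"
proof -
  interpret group G by fact
  interpret A: group A by fact
  interpret f: group_hom A G f using f by unfold_locales
  note restr = Irr_pullback_multiple[OF G fin A f conj]
  obtain \<theta> where \<theta>: "\<theta> \<in> Irr A" "\<And>a. a \<in> carrier A \<Longrightarrow> \<chi> (f a) * \<theta> \<one>\<^bsub>A\<^esub> = \<theta> a * \<chi> \<one>"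
    using restr \<chi> by metis
  obtain \<eta> where \<eta>: "\<eta> \<in> Irr A" "\<And>a. a \<in> carrier A \<Longrightarrow> \<phi> (f a) * \<eta> \<one>\<^bsub>A\<^esub> = \<eta> a * \<phi> \<one>"
    using restr \<phi> by metis
  obtain n where n: "0 < n" "\<chi> \<one> = of_nat n" using Irr_one[OF G \<chi>] .
  obtain m where m: "0 < m" "\<phi> \<one> = of_nat m" using Irr_one[OF G \<phi>] .
  obtain k where k: "0 < k" "\<theta> \<one>\<^bsub>A\<^esub> = of_nat k" using Irr_one[OF A \<theta>(1)] .
  obtain l where l: "0 < l" "\<eta> \<one>\<^bsub>A\<^esub> = of_nat l" using Irr_one[OF A \<eta>(1)] .
  have "\<theta> \<noteq> \<eta>"
  proof
    assume eq: "\<theta> = \<eta>"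
    have "\<chi> (f a) * \<phi> \<one> * \<theta> \<one>\<^bsub>A\<^esub> = \<phi> (f a) * \<chi> \<one> * \<theta> \<one>\<^bsub>A\<^esub>"
      using \<theta>(2)[OF a(1)] \<eta>(2)[OF a(1)] by (simp add: eq mult_ac)
    then show False using a(2) k by simp
  qed
  then obtain H \<mu> where H: "S H" and \<mu>: "linear_character (A\<lparr>carrier := H\<rparr>) \<mu>"
    and in_Cons: "\<theta> \<in> Cons A (induced_character A H \<mu>)"
    and notin_Cons: "\<eta> \<notin> Cons A (induced_character A H \<mu>)"
    using sep \<theta>(1) \<eta>(1) unfolding separates_characters_def by blast
  have HA: "subgroup H A" using sub H by blast
  note HsubA = subgroup.subset[OF HA]
  have K: "group (A\<lparr>carrier := H\<rparr>)" using HA A.subgroup_imp_group by blast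
  have fK: "group_hom (A\<lparr>carrier := H\<rparr>) G f"
    using K group_axioms HsubA by (auto simp: group_hom_def group_hom_axioms_def hom_def subset_iff)
  have inner_f: "(\<Sum>h\<in>H. \<psi> (f h) * cnj (\<mu> h)) / of_nat (card H) =
      (of_nat d / of_nat e) * char_inner A \<zeta> (induced_character A H \<mu>)"
    if \<zeta>: "\<zeta> \<in> Irr A" and scaled: "\<And>a. a \<in> carrier A \<Longrightarrow> \<psi> (f a) * of_nat e = \<zeta> a * of_nat d"
      and e: "0 < e"
    for \<psi> \<zeta> d e
  proof -
    have "\<psi> (f h) = (of_nat d / of_nat e) * \<zeta> h" if "h \<in> H" for h
      using that e scaled[of h] HsubA by (auto simp: field_simps)
    then have "(\<Sum>h\<in>H. \<psi> (f h) * cnj (\<mu> h)) = (of_nat d / of_nat e) * (\<Sum>h\<in>H. \<zeta> h * cnj (\<mu> h))"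
      by (simp add: sum_distrib_left mult_ac cong: sum.cong)
    then show ?thesis using char_inner_induced[OF A finA HsubA \<zeta>] by simp
  qed
  have scale_pos: "0 < (of_nat d / of_nat e) * z \<longleftrightarrow> 0 < z" if "0 < d" "0 < e" for d e :: nat and z :: complex
  proof -
    have "of_nat d / of_nat e = complex_of_real (real d / real e)" by simp
    then show ?thesis using that
      by (simp only: less_complex_def Re_complex_of_real Im_complex_of_real times_complex.sel)
        (auto simp: zero_less_mult_iff zero_less_divide_iff)
  qed
  have "(\<Sum>h\<in>H. \<chi> (f h) * cnj (\<mu> h)) / of_nat (card H) =
      (of_nat n / of_nat k) * char_inner A \<theta> (induced_character A H \<mu>)"
    using \<theta> n k by (intro inner_f) auto
  then have pos: "0 < (\<Sum>h\<in>H. \<chi> (f h) * cnj (\<mu> h)) / of_nat (card H)"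
    using in_Cons scale_pos[OF n(1) k(1)] by (simp only: Cons_def mem_Collect_eq simp_thms)
  have "(\<Sum>h\<in>H. \<phi> (f h) * cnj (\<mu> h)) / of_nat (card H) =
      (of_nat m / of_nat l) * char_inner A \<eta> (induced_character A H \<mu>)"
    using \<eta> m l by (intro inner_f) auto
  then have not_pos: "\<not> 0 < (\<Sum>h\<in>H. \<phi> (f h) * cnj (\<mu> h)) / of_nat (card H)"
    using notin_Cons \<eta>(1) scale_pos[OF m(1) l(1)] by (simp only: Cons_def mem_Collect_eq simp_thms)
  have \<mu>_mult: "\<mu> (x \<otimes>\<^bsub>A\<^esub> y) = \<mu> x * \<mu> y" if "x \<in> H" "y \<in> H" for x y
    using \<mu> that unfolding linear_character_iff[OF K] by simp
  (* Translating by k multiplies the positive inner product of chi o f with mu by cnj (mu k). *)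
  have ker: "\<mu> k = 1" if k: "k \<in> H" "f k = \<one>" for k
  proof -
    have "(\<Sum>h\<in>H. \<chi> (f h) * cnj (\<mu> h)) = (\<Sum>h\<in>H. \<chi> (f (h \<otimes>\<^bsub>A\<^esub> k)) * cnj (\<mu> (h \<otimes>\<^bsub>A\<^esub> k)))"
      using k HA HsubA
      by (intro sum.reindex_bij_witness[where j = "\<lambda>h. h \<otimes>\<^bsub>A\<^esub> inv\<^bsub>A\<^esub> k" and i = "\<lambda>h. h \<otimes>\<^bsub>A\<^esub> k"])
        (auto simp: A.m_assoc subsetD subgroup.m_closed subgroup.m_inv_closed)
    also have "\<dots> = (\<Sum>h\<in>H. \<chi> (f h) * cnj (\<mu> h)) * cnj (\<mu> k)"
      using k HsubA by (simp add: \<mu>_mult sum_distrib_left subsetD mult_ac cong: sum.cong)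
    finally have "cnj (\<mu> k) = 1" using pos by auto
    then show ?thesis by (metis complex_cnj_cnj complex_cnj_one)
  qed
  obtain \<nu> where \<nu>: "linear_character (G\<lparr>carrier := f ` H\<rparr>) \<nu>" "\<And>h. h \<in> H \<Longrightarrow> \<nu> (f h) = \<mu> h"
    using linear_character_factors[OF fK \<mu>] ker by auto
  have fHG: "f ` H \<subseteq> carrier G" using HsubA by auto
  have inner: "char_inner G \<psi> (induced_character G (f ` H) \<nu>) =
      (\<Sum>h\<in>H. \<psi> (f h) * cnj (\<mu> h)) / of_nat (card H)" if "\<psi> \<in> Irr G" for \<psi>
    using sum_hom_image[OF fK, of "\<lambda>y. \<psi> y * cnj (\<nu> y)"] finite_subset[OF HsubA finA]
    by (simp add: char_inner_induced[OF G fin fHG that] \<nu>(2) cong: sum.cong)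
  have "\<chi> \<in> Cons G (induced_character G (f ` H) \<nu>)" "\<phi> \<notin> Cons G (induced_character G (f ` H) \<nu>)"
    using pos not_pos \<chi> by (simp_all add: Cons_def inner \<chi> \<phi>)
  then show ?thesis using H \<nu>(1) by blast
qed

section \<open>Central products\<close>

text \<open>If \<open>G\<close> is generated by elementwise commuting images of \<open>A\<close> and \<open>B\<close>, then the part of \<open>g\<close> that
  comes from \<open>B\<close> has no effect in conjugating \<open>f a\<close>.\<close>

lemma central_product_conj:
  fixes G (structure)
  assumes "group_hom A G f" "group_hom B G h"
    and comm: "\<And>a b. a \<in> carrier A \<Longrightarrow> b \<in> carrier B \<Longrightarrow> f a \<otimes> h b = h b \<otimes> f a"
    and gen: "\<And>g. g \<in> carrier G \<Longrightarrow> \<exists>a\<in>carrier A. \<exists>b\<in>carrier B. g = f a \<otimes> h b"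
    and g: "g \<in> carrier G" and a: "a \<in> carrier A"
  shows "\<exists>c\<in>carrier A. g \<otimes> f a \<otimes> inv g = f (c \<otimes>\<^bsub>A\<^esub> a \<otimes>\<^bsub>A\<^esub> inv\<^bsub>A\<^esub> c)"
proof -
  interpret f: group_hom A G f by fact
  interpret h: group_hom B G h by fact
  obtain c b where c: "c \<in> carrier A" and b: "b \<in> carrier B" and gcb: "g = f c \<otimes> h b"
    using gen[OF g] by blast
  have "g \<otimes> f a \<otimes> inv g = f c \<otimes> (h b \<otimes> f a) \<otimes> (inv (h b) \<otimes> inv (f c))"
    using a b c by (simp add: gcb f.H.inv_mult_group f.H.m_assoc)
  also have "\<dots> = f c \<otimes> (f a \<otimes> h b) \<otimes> (inv (h b) \<otimes> inv (f c))" using comm[OF a b] by simp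
  also have "\<dots> = f c \<otimes> f a \<otimes> ((h b \<otimes> inv (h b)) \<otimes> inv (f c))"
    using a b c by (simp only: f.H.m_assoc f.H.m_closed f.H.inv_closed f.hom_closed h.hom_closed)
  also have "\<dots> = f (c \<otimes>\<^bsub>A\<^esub> a \<otimes>\<^bsub>A\<^esub> inv\<^bsub>A\<^esub> c)" using a b c by simp
  finally show ?thesis using c by blast
qed

text \<open>The product formula gives \<open>\<chi> \<one> * \<chi> (f a \<otimes> h b) = \<chi> (f a) * \<chi> (h b)\<close>. Hence an irreducible character
  is determined, up to a factor that its norm fixes, by its pullbacks to \<open>A\<close> and \<open>B\<close>; two different
  characters already differ on one of these two groups, after normalisation by the degrees.\<close>

lemma separates_characters_central_product:
  fixes G (structure)
  assumes f: "group_hom A G f" and h: "group_hom B G h"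
    and fin: "finite (carrier G)" "finite (carrier A)" "finite (carrier B)"
    and comm: "\<And>a b. a \<in> carrier A \<Longrightarrow> b \<in> carrier B \<Longrightarrow> f a \<otimes> h b = h b \<otimes> f a"
    and gen: "\<And>g. g \<in> carrier G \<Longrightarrow> \<exists>a\<in>carrier A. \<exists>b\<in>carrier B. g = f a \<otimes> h b"
    and sepA: "separates_characters A S" and S: "\<And>H. S H \<Longrightarrow> subgroup H A" "\<And>H. S H \<Longrightarrow> U (f ` H)"
    and sepB: "separates_characters B T" and T: "\<And>H. T H \<Longrightarrow> subgroup H B" "\<And>H. T H \<Longrightarrow> U (h ` H)"
  shows "separates_characters G U"
  unfolding separates_characters_def
proof (intro ballI impI)
  interpret f: group_hom A G f by fact
  interpret h: group_hom B G h by fact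
  have G: "group G" and A: "group A" and B: "group B" by unfold_locales
  have conj_f: "\<exists>c\<in>carrier A. g \<otimes> f a \<otimes> inv g = f (c \<otimes>\<^bsub>A\<^esub> a \<otimes>\<^bsub>A\<^esub> inv\<^bsub>A\<^esub> c)"
    if "g \<in> carrier G" "a \<in> carrier A" for g a
    using central_product_conj[OF f h comm gen that] .
  have conj_h: "\<exists>c\<in>carrier B. g \<otimes> h b \<otimes> inv g = h (c \<otimes>\<^bsub>B\<^esub> b \<otimes>\<^bsub>B\<^esub> inv\<^bsub>B\<^esub> c)"
    if "g \<in> carrier G" "b \<in> carrier B" for g b
    using comm gen by (intro central_product_conj[OF h f _ _ that]) (simp, metis)
  have prod: "\<psi> \<one> * \<psi> (f a \<otimes> h b) = \<psi> (f a) * \<psi> (h b)"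
    if \<psi>: "\<psi> \<in> Irr G" and a: "a \<in> carrier A" and b: "b \<in> carrier B" for \<psi> a b
  proof -
    have "\<psi> (f a \<otimes> (x \<otimes> h b \<otimes> inv x)) = \<psi> (f a \<otimes> h b)" if x: "x \<in> carrier G" for x
    proof -
      obtain c where c: "c \<in> carrier B" "x \<otimes> h b \<otimes> inv x = h (c \<otimes>\<^bsub>B\<^esub> b \<otimes>\<^bsub>B\<^esub> inv\<^bsub>B\<^esub> c)"
        using conj_h[OF x b] by blast
      have "f a \<otimes> (x \<otimes> h b \<otimes> inv x) = f a \<otimes> h c \<otimes> (h b \<otimes> inv (h c))"
        using a b c(1) by (simp add: c(2) f.H.m_assoc)
      also have "\<dots> = f a \<otimes> h c \<otimes> h b \<otimes> inv (h c)" using a b c(1) by (simp add: f.H.m_assoc)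
      also have "\<dots> = h c \<otimes> (f a \<otimes> h b) \<otimes> inv (h c)"
        unfolding comm[OF a c(1)] using a b c(1) by (simp add: f.H.m_assoc)
      finally show ?thesis using Irr_conj[OF G \<psi>] a b c(1) by simp
    qed
    then show ?thesis
      using Irr_product_formula[OF G fin(1) \<psi>, of "f a" "h b"] a b fin(1)
      by (auto simp: card_gt_0_iff)
  qed
  fix \<chi> \<phi> assume \<chi>: "\<chi> \<in> Irr G" and \<phi>: "\<phi> \<in> Irr G" and "\<chi> \<noteq> \<phi>"
  obtain n where n: "0 < n" "\<chi> \<one> = of_nat n" using Irr_one[OF G \<chi>] .
  obtain m where m: "0 < m" "\<phi> \<one> = of_nat m" using Irr_one[OF G \<phi>] .
  from \<open>\<chi> \<noteq> \<phi>\<close> obtain g where g: "g \<in> carrier G" "\<chi> g * \<phi> \<one> \<noteq> \<phi> g * \<chi> \<one>"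
    using Irr_proportional_eq[OF G fin(1) \<chi> \<phi>] by blast
  from gen[OF g(1)] obtain a b where a: "a \<in> carrier A" and b: "b \<in> carrier B"
    and gab: "g = f a \<otimes> h b" by blast
  have "\<chi> (f a) * \<phi> \<one> \<noteq> \<phi> (f a) * \<chi> \<one> \<or> \<chi> (h b) * \<phi> \<one> \<noteq> \<phi> (h b) * \<chi> \<one>"
  proof (rule ccontr)
    assume "\<not> ?thesis"
    then have eq: "\<chi> (f a) * \<phi> \<one> = \<phi> (f a) * \<chi> \<one>" "\<chi> (h b) * \<phi> \<one> = \<phi> (h b) * \<chi> \<one>" by auto
    have "(\<chi> g * \<phi> \<one>) * (\<chi> \<one> * \<phi> \<one>) = (\<chi> (f a) * \<phi> \<one>) * (\<chi> (h b) * \<phi> \<one>)"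
      using prod[OF \<chi> a b] by (simp add: gab mult_ac)
    also have "\<dots> = (\<phi> g * \<chi> \<one>) * (\<chi> \<one> * \<phi> \<one>)"
      unfolding eq using prod[OF \<phi> a b] by (simp add: gab mult_ac)
    finally show False using g(2) n m by simp
  qed
  then show "\<exists>H \<mu>. U H \<and> linear_character (G\<lparr>carrier := H\<rparr>) \<mu> \<and>
      \<chi> \<in> Cons G (induced_character G H \<mu>) \<and> \<phi> \<notin> Cons G (induced_character G H \<mu>)"
  proof
    assume "\<chi> (f a) * \<phi> \<one> \<noteq> \<phi> (f a) * \<chi> \<one>"
    from separate_by_pushforward[OF G fin(1) A fin(2) f.homh conj_f sepA S(1) \<chi> \<phi> a this]
    show ?thesis using S(2) by blast
  next
    assume "\<chi> (h b) * \<phi> \<one> \<noteq> \<phi> (h b) * \<chi> \<one>"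
    from separate_by_pushforward[OF G fin(1) B fin(3) h.homh conj_h sepB T(1) \<chi> \<phi> b this]
    show ?thesis using T(2) by blast
  qed
qed

section \<open>Images of normal and subnormal subgroups\<close>

lemma normal_image_hom:
  assumes "group_hom A G f" and K: "subgroup K A" and H: "H \<lhd> A\<lparr>carrier := K\<rparr>"
  shows "f ` H \<lhd> G\<lparr>carrier := f ` K\<rparr>"
proof -
  interpret group_hom A G f by fact
  have gK: "group (A\<lparr>carrier := K\<rparr>)" using K G.subgroup_imp_group by blast
  have sH: "subgroup H (A\<lparr>carrier := K\<rparr>)" using H by (rule normal_imp_subgroup)
  have HK: "H \<subseteq> K" using subgroup.subset[OF sH] by simp
  have HA: "subgroup H A" using G.incl_subgroup[OF K sH] .
  have fK: "subgroup (f ` K) G" using subgroup_img_is_subgroup[OF K] .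
  have fH: "subgroup (f ` H) G" using subgroup_img_is_subgroup[OF HA] .
  have gfK: "group (G\<lparr>carrier := f ` K\<rparr>)" using fK H.subgroup_imp_group by blast
  have "subgroup (f ` H) (G\<lparr>carrier := f ` K\<rparr>)"
    using H.subgroup_incl[OF fH fK] HK by blast
  moreover have "f k \<otimes>\<^bsub>G\<^esub> f x \<otimes>\<^bsub>G\<^esub> inv\<^bsub>G\<^esub> (f k) \<in> f ` H" if k: "k \<in> K" and x: "x \<in> H" for k x
  proof -
    have "k \<otimes>\<^bsub>A\<^esub> x \<otimes>\<^bsub>A\<^esub> inv\<^bsub>A\<^esub> k \<in> H"
      using group.normal_inv_iff[OF gK, of H] H k x G.m_inv_consistent[OF K k] by auto
    moreover have "k \<in> carrier A" "x \<in> carrier A"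
      using k x subgroup.subset[OF K] subgroup.subset[OF HA] by auto
    ultimately show ?thesis by (intro image_eqI) auto
  qed
  ultimately show ?thesis
    using H.m_inv_consistent[OF fK] by (auto simp: group.normal_inv_iff[OF gfK])
qed

lemma normal_image_of_conj_stable_hom:
  fixes G (structure)
  assumes "group_hom A G f" and N: "N \<lhd> A"
    and conj: "\<And>g a. g \<in> carrier G \<Longrightarrow> a \<in> carrier A \<Longrightarrow>
      \<exists>b\<in>carrier A. g \<otimes> f a \<otimes> inv g = f (b \<otimes>\<^bsub>A\<^esub> a \<otimes>\<^bsub>A\<^esub> inv\<^bsub>A\<^esub> b)"
  shows "f ` N \<lhd> G"
proof -
  interpret group_hom A G f by fact
  have sN: "subgroup N A" using N by (rule normal_imp_subgroup)
  have "g \<otimes> f a \<otimes> inv g \<in> f ` N" if g: "g \<in> carrier G" and a: "a \<in> N" for g a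
  proof -
    have aA: "a \<in> carrier A" using a subgroup.subset[OF sN] by auto
    obtain b where b: "b \<in> carrier A" "g \<otimes> f a \<otimes> inv g = f (b \<otimes>\<^bsub>A\<^esub> a \<otimes>\<^bsub>A\<^esub> inv\<^bsub>A\<^esub> b)"
      using conj[OF g aA] by blast
    then show ?thesis using N a by (auto simp: G.normal_inv_iff)
  qed
  then show ?thesis using subgroup_img_is_subgroup[OF sN] by (auto simp: H.normal_inv_iff)
qed

lemma subnormal_imp_subgroup:
  assumes "group G" "subnormal G H"
  shows "subgroup H G"
  using assms(2)
proof induction
  case whole
  then show ?case using assms(1) by (simp add: group.subgroup_self)
next
  case (step K H)
  then show ?case using group.incl_subgroup[OF assms(1)] normal_imp_subgroup by blast
qed

text \<open>A homomorphism that is not surjective need not preserve subnormality, but here the image of \<open>A\<close>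
  is normal in \<open>G\<close>, and a subnormal chain of \<open>A\<close> is mapped to one that starts there.\<close>

lemma subnormal_image_of_conj_stable_hom:
  fixes G (structure)
  assumes f: "group_hom A G f" and H: "subnormal A H"
    and conj: "\<And>g a. g \<in> carrier G \<Longrightarrow> a \<in> carrier A \<Longrightarrow>
      \<exists>b\<in>carrier A. g \<otimes> f a \<otimes> inv g = f (b \<otimes>\<^bsub>A\<^esub> a \<otimes>\<^bsub>A\<^esub> inv\<^bsub>A\<^esub> b)"
  shows "subnormal G (f ` H)"
  using H
proof induction
  interpret group_hom A G f by fact
  case whole
  have "carrier A \<lhd> A" by (simp add: G.normal_inv_iff G.subgroup_self)
  then have "f ` carrier A \<lhd> G" by (rule normal_image_of_conj_stable_hom[OF f _ conj])
  then show ?case by (intro subnormal.step[OF subnormal.whole]) simp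
next
  interpret group_hom A G f by fact
  case (step K H)
  then show ?case
    using normal_image_hom[OF f] subnormal_imp_subgroup[OF G.is_group] subnormal.step by blast
qed

section \<open>Factor groups and direct products\<close>

lemma nAM_group_iff:
  "nAM_group G \<longleftrightarrow> group G \<and> finite (carrier G) \<and> separates_characters G (\<lambda>N. N \<lhd> G)"
  by (simp add: nAM_group_def separates_characters_def)

lemma sAM_group_iff:
  "sAM_group G \<longleftrightarrow> group G \<and> finite (carrier G) \<and> separates_characters G (subnormal G)"
  by (simp add: sAM_group_def separates_characters_def)

lemma
  fixes G (structure)
  assumes f: "group_hom A G f" and h: "group_hom B G h"
    and comm: "\<And>a b. a \<in> carrier A \<Longrightarrow> b \<in> carrier B \<Longrightarrow> f a \<otimes> h b = h b \<otimes> f a"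
    and gen: "\<And>g. g \<in> carrier G \<Longrightarrow> \<exists>a\<in>carrier A. \<exists>b\<in>carrier B. g = f a \<otimes> h b"
  shows nAM_group_central_product: "nAM_group A \<Longrightarrow> nAM_group B \<Longrightarrow> nAM_group G"
    and sAM_group_central_product: "sAM_group A \<Longrightarrow> sAM_group B \<Longrightarrow> sAM_group G"
proof -
  interpret f: group_hom A G f by fact
  interpret h: group_hom B G h by fact
  have G: "group G" and A: "group A" and B: "group B" by unfold_locales
  have conj_f: "\<exists>c\<in>carrier A. g \<otimes> f a \<otimes> inv g = f (c \<otimes>\<^bsub>A\<^esub> a \<otimes>\<^bsub>A\<^esub> inv\<^bsub>A\<^esub> c)"
    if "g \<in> carrier G" "a \<in> carrier A" for g a
    using central_product_conj[OF f h comm gen that] .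
  have conj_h: "\<exists>c\<in>carrier B. g \<otimes> h b \<otimes> inv g = h (c \<otimes>\<^bsub>B\<^esub> b \<otimes>\<^bsub>B\<^esub> inv\<^bsub>B\<^esub> c)"
    if "g \<in> carrier G" "b \<in> carrier B" for g b
    using comm gen by (intro central_product_conj[OF h f _ _ that]) (simp, metis)
  have finG: "finite (carrier G)" if "finite (carrier A)" "finite (carrier B)"
  proof (rule finite_subset)
    show "carrier G \<subseteq> (\<lambda>(a,b). f a \<otimes> h b) ` (carrier A \<times> carrier B)" using gen by force
  qed (use that in simp)
  show "nAM_group G" if "nAM_group A" "nAM_group B"
    using that separates_characters_central_product[OF f h _ _ _ comm gen,
        where S = "\<lambda>N. N \<lhd> A" and T = "\<lambda>N. N \<lhd> B" and U = "\<lambda>N. N \<lhd> G"]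
      normal_image_of_conj_stable_hom[OF f _ conj_f] normal_image_of_conj_stable_hom[OF h _ conj_h]
    by (simp add: nAM_group_iff finG G normal_imp_subgroup)
  show "sAM_group G" if "sAM_group A" "sAM_group B"
    using that separates_characters_central_product[OF f h _ _ _ comm gen,
        where S = "subnormal A" and T = "subnormal B" and U = "subnormal G"]
      subnormal_image_of_conj_stable_hom[OF f _ conj_f] subnormal_image_of_conj_stable_hom[OF h _ conj_h]
      subnormal_imp_subgroup[OF A] subnormal_imp_subgroup[OF B]
    by (simp add: sAM_group_iff finG G)
qed

text \<open>The factor group is the central product of the projection and the trivial homomorphism. Taking
  \<open>G\<close> as the domain of the trivial homomorphism makes both factors groups of the given class.\<close>

lemma
  assumes N: "N \<lhd> G"
  shows nAM_group_factor: "nAM_group G \<Longrightarrow> nAM_group (G Mod N)"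
    and sAM_group_factor: "sAM_group G \<Longrightarrow> sAM_group (G Mod N)"
proof -
  interpret normal N G by fact
  interpret Q: group "G Mod N" by (rule factorgroup_is_group)
  let ?p = "\<lambda>g. N #>\<^bsub>G\<^esub> g" and ?t = "\<lambda>g::'a. \<one>\<^bsub>G Mod N\<^esub>"
  have p: "group_hom G (G Mod N) ?p"
    using r_coset_hom_Mod by unfold_locales
  have t: "group_hom G (G Mod N) ?t" using trivial_hom[OF Q.is_group] by unfold_locales
  interpret p: group_hom G "G Mod N" ?p by fact
  have comm: "?p a \<otimes>\<^bsub>G Mod N\<^esub> ?t b = ?t b \<otimes>\<^bsub>G Mod N\<^esub> ?p a" if "a \<in> carrier G" for a b
    using p.hom_closed[OF that] by (simp only: Q.r_one Q.l_one)
  have gen: "\<exists>a\<in>carrier G. \<exists>b\<in>carrier G. g = ?p a \<otimes>\<^bsub>G Mod N\<^esub> ?t b" if g: "g \<in> carrier (G Mod N)" for g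
  proof -
    obtain a where a: "a \<in> carrier G" "g = ?p a"
      using g by (auto simp: FactGroup_def RCOSETS_def)
    then have "g = ?p a \<otimes>\<^bsub>G Mod N\<^esub> ?t a" using p.hom_closed[OF a(1)] by (simp only: Q.r_one)
    then show ?thesis using a(1) by blast
  qed
  show "nAM_group G \<Longrightarrow> nAM_group (G Mod N)"
    using nAM_group_central_product[OF p t comm gen] by blast
  show "sAM_group G \<Longrightarrow> sAM_group (G Mod N)"
    using sAM_group_central_product[OF p t comm gen] by blast
qed

lemma
  shows nAM_group_DirProd: "nAM_group G1 \<Longrightarrow> nAM_group G2 \<Longrightarrow> nAM_group (G1 \<times>\<times> G2)"
    and sAM_group_DirProd: "sAM_group G1 \<Longrightarrow> sAM_group G2 \<Longrightarrow> sAM_group (G1 \<times>\<times> G2)"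
proof -
  let ?f = "\<lambda>a. (a, \<one>\<^bsub>G2\<^esub>)" and ?h = "\<lambda>b. (\<one>\<^bsub>G1\<^esub>, b)"
  have "group_hom G1 (G1 \<times>\<times> G2) ?f \<and> group_hom G2 (G1 \<times>\<times> G2) ?h \<and>
    (\<forall>a\<in>carrier G1. \<forall>b\<in>carrier G2. ?f a \<otimes>\<^bsub>G1 \<times>\<times> G2\<^esub> ?h b = ?h b \<otimes>\<^bsub>G1 \<times>\<times> G2\<^esub> ?f a) \<and>
    (\<forall>g\<in>carrier (G1 \<times>\<times> G2). \<exists>a\<in>carrier G1. \<exists>b\<in>carrier G2. g = ?f a \<otimes>\<^bsub>G1 \<times>\<times> G2\<^esub> ?h b)"
    if "group G1" "group G2"
  proof -
    interpret G1: group G1 by fact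
    interpret G2: group G2 by fact
    show ?thesis
      by (auto simp: group_hom_def group_hom_axioms_def hom_def DirProd_group)
  qed
  note inclusions = this
  show "nAM_group (G1 \<times>\<times> G2)" if "nAM_group G1" "nAM_group G2"
  proof -
    have "group G1" "group G2" using that by (simp_all add: nAM_group_iff)
    from inclusions[OF this] show ?thesis
      using nAM_group_central_product[of G1 "G1 \<times>\<times> G2" ?f G2 ?h, OF _ _ _ _ that] by blast
  qed
  show "sAM_group (G1 \<times>\<times> G2)" if "sAM_group G1" "sAM_group G2"
  proof -
    have "group G1" "group G2" using that by (simp_all add: sAM_group_iff)
    from inclusions[OF this] show ?thesis
      using sAM_group_central_product[of G1 "G1 \<times>\<times> G2" ?f G2 ?h, OF _ _ _ _ that] by blast
  qed
qed

theorem theorem5p2: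
  fixes G :: "('a, 'r) monoid_scheme" and N :: "'a set"
    and G1 :: "('b, 's) monoid_scheme" and G2 :: "('c, 't) monoid_scheme"
  shows "(nAM_group G \<and> N \<lhd> G \<longrightarrow> nAM_group (G Mod N)) \<and>
         (sAM_group G \<and> N \<lhd> G \<longrightarrow> sAM_group (G Mod N)) \<and>
         (nAM_group G1 \<and> nAM_group G2 \<longrightarrow> nAM_group (G1 \<times>\<times> G2)) \<and>
         (sAM_group G1 \<and> sAM_group G2 \<longrightarrow> sAM_group (G1 \<times>\<times> G2))"
  using nAM_group_factor sAM_group_factor nAM_group_DirProd sAM_group_DirProd by blast

end
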